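(* Let $B_n$ be a prime bouquet with $n\ge 3$ edges. The lowest-degree (nonzero) term of the partial Petrial polynomial $^{\partial}\varepsilon_{B_n}^{\times}(z)$ is of degree $2$ if and only if the intersection graph $I(B_n)$ satisfies one of the following conditions (for some integers $i,j,k$ in the admissible ranges): (1) $I(B_n)=K_{i,j,k}$, where $k=0$, or ($i+j\ge 3$ and $k\ne 0$); (2) $I(B_n)=F_{i,j,k}$, where $j\ne 0$, or ($j=0$ and $k\ge 2$).
   Context: A ribbon graph $G$ is a surface with boundary represented as the union of two finite sets of closed topological discs, vertex-discs $V(G)$ and edge-ribbons $E(G)$, such that: vertex-discs and edge-ribbons intersect in disjoint line segments; each such segment lies on the boundary of precisely one vertex-disc and precisely one edge-ribbon; every edge-ribbon contains exactly two such segments. All graphs are connected (loops and multiple edges allowed). Let $F(G)$ be the set of faces (boundary components of the surface) and $c(G)$ the number of connected components. The Euler genus is $\varepsilon(G)=2c(G)-|V(G)|+|E(G)|-|F(G)|$. For $A\subseteq E(G)$, the partial Petrial $G^{\times|A}$ is obtained by detaching one end of each edge-ribbon in $A$ from its incident vertex-disc, giving the edge a half-twist, and reattaching it. The partial Petrial polynomial is $^{\partial}\varepsilon_G^{\times}(z)=\sum_{A\subseteq E(G)}z^{\varepsilon(G^{\times|A})}$. The join $G_1\vee G_2$ of disjoint ribbon graphs is obtained by choosing, for each $i=1,2$, an arc $p_i$ on the boundary of a vertex-disc of $G_i$ between two consecutive ribbon ends, and identifying $p_1$ with $p_2$ so that the two vertex-discs merge into one. A ribbon graph $G$ is prime if there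 are no non-empty subgraphs $G_1,G_2$ (a ribbon graph is empty if its edge set is empty) with $G=G_1\vee G_2$. A bouquet is a ribbon graph with exactly one vertex-disc. Two edges (loops) of a bouquet are interlaced if their half-edges alternate in the cyclic order of half-edges around the vertex-disc. The intersection graph $I(B)$ of a bouquet $B$ has the loops of $B$ as vertices, two being adjacent if and only if the loops are interlaced. $K_{i,j,k}$ (with $i,j\ge 1$, $k\ge 0$) denotes the complete tripartite graph with parts of sizes $i,j,k$ when $k\neq 0$, and $K_{i,j,0}$ denotes the complete bipartite graph $K_{i,j}$. A graph $G$ is called $F_{i,j,k}$ (with $i\ge1$, $j\ge 0$, $k\ge 1$) if $V(G)$ is a disjoint union $V_1\cup V_2\cup V_3$ such that $G[V_1]\cong K_i$ and $G[V_2]\cong K_j$ are complete, there are no edges between $V_1$ and $V_2$, $V_3$ is an independent set with $|V_3|=k$, and every vertex of $V_3$ is adjacent to all vertices of $V_1\cup V_2$. Equality of graphs means isomorphism. *)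

theory Defs
  imports Main "HOL-Computational_Algebra.Polynomial"
begin

text \<open>
  Ribbon graphs, up to homeomorphism, are encoded by their corners: the end points of the line
  segments in which vertex-discs meet edge-ribbons. A corner lies on exactly one common
  segment, on exactly one free side of an edge-ribbon and on exactly one free boundary arc of a
  vertex-disc; \<open>seg\<close>, \<open>side\<close> and \<open>arc\<close> send a corner to the other end point of
  the respective curve. Vertex-discs that meet no ribbon have no corners and are only counted
  (\<open>bare\<close>).
\<close>

record 'c ribbon =
  corners :: "'c set"
  seg :: "'c \<Rightarrow> 'c"
  side :: "'c \<Rightarrow> 'c"
  arc :: "'c \<Rightarrow> 'c"
  bare :: nat

text \<open>The identity requirement outside \<open>C\<close> makes equality of records the
  equality of the encoded ribbon graphs.\<close>

definition pairing :: "'c set \<Rightarrow> ('c \<Rightarrow> 'c) \<Rightarrow> bool" where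
  "pairing C f \<longleftrightarrow>
     (\<forall>x\<in>C. f x \<in> C \<and> f x \<noteq> x \<and> f (f x) = x) \<and> (\<forall>x. x \<notin> C \<longrightarrow> f x = x)"

text \<open>The last condition says that the boundary of an edge-ribbon is a quadrilateral
  segment, side, segment, side with four distinct corners, i.e. that it contains exactly two
  segments. No such restriction applies to \<open>seg\<close> and \<open>arc\<close>: any alternating cycle of
  these bounds a vertex-disc.\<close>

definition ribbon_graph :: "'c ribbon \<Rightarrow> bool" where
  "ribbon_graph G \<longleftrightarrow> finite (corners G) \<and>
     pairing (corners G) (seg G) \<and> pairing (corners G) (side G) \<and> pairing (corners G) (arc G) \<and>
     (\<forall>x\<in>corners G. seg G (side G x) = side G (seg G x) \<and> side G x \<noteq> seg G x)"

text \<open>The equivalence classes of corners joined by chains of curves of the kinds in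
  \<open>S\<close>; \<open>S\<close> will consist of pairings, so the reflexive transitive closure is symmetric.\<close>

definition orbits :: "'c set \<Rightarrow> ('c \<Rightarrow> 'c) set \<Rightarrow> 'c set set" where
  "orbits C S = C // {(x, f x) | x f. x \<in> C \<and> f \<in> S}\<^sup>*"

definition edges :: "'c ribbon \<Rightarrow> 'c set set" where
  "edges G = orbits (corners G) {seg G, side G}"

definition num_vertices :: "'c ribbon \<Rightarrow> nat" where
  "num_vertices G = card (orbits (corners G) {seg G, arc G}) + bare G"

text \<open>The boundary of the surface is made of the free sides of edge-ribbons and the free arcs
  of vertex-discs; a bare vertex-disc contributes its boundary circle.\<close>

definition num_faces :: "'c ribbon \<Rightarrow> nat" where
  "num_faces G = card (orbits (corners G) {side G, arc G}) + bare G"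

definition num_components :: "'c ribbon \<Rightarrow> nat" where
  "num_components G = card (orbits (corners G) {seg G, side G, arc G}) + bare G"

definition euler_genus :: "'c ribbon \<Rightarrow> int" where
  "euler_genus G = 2 * int (num_components G) - int (num_vertices G)
     + int (card (edges G)) - int (num_faces G)"

text \<open>Let \<open>x\<close>, \<open>seg x\<close> be the corners of one end of an edge-ribbon, joined by its sides
  to \<open>side x\<close> and \<open>side (seg x) = seg (side x)\<close> respectively. Reattaching either end with
  a half-twist makes the sides run from \<open>x\<close> to \<open>seg (side x)\<close> and from
  \<open>seg x\<close> to \<open>side x\<close>.\<close>

definition partial_petrial :: "'c ribbon \<Rightarrow> 'c set set \<Rightarrow> 'c ribbon" where
  "partial_petrial G A =
     G\<lparr>side := (\<lambda>x. if x \<in> \<Union>A then seg G (side G x) else side G x)\<rparr>"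

text \<open>The Euler genus is never negative, so \<open>nat\<close> does not truncate.\<close>

definition partial_petrial_poly :: "'c ribbon \<Rightarrow> int poly" where
  "partial_petrial_poly G =
     (\<Sum>A\<in>Pow (edges G). monom 1 (nat (euler_genus (partial_petrial G A))))"

definition lowest_degree :: "'a::zero poly \<Rightarrow> nat" where
  "lowest_degree p = (LEAST d. coeff p d \<noteq> 0)"

text \<open>The join of disjoint \<open>G1\<close> and \<open>G2\<close> along the arc from \<open>p\<close> to \<open>arc G1 p\<close>
  and the arc from \<open>q\<close> to \<open>arc G2 q\<close>, the end point \<open>p\<close> being identified with
  \<open>q\<close>. The merged vertex-disc has free arcs from \<open>p\<close> to \<open>q\<close> and from
  \<open>arc G1 p\<close> to \<open>arc G2 q\<close> instead. The other way of identifying the two arcs is obtained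
  by taking \<open>arc G2 q\<close> in place of \<open>q\<close>.\<close>

definition join :: "'c ribbon \<Rightarrow> 'c \<Rightarrow> 'c ribbon \<Rightarrow> 'c \<Rightarrow> 'c ribbon" where
  "join G1 p G2 q =
     \<lparr>corners = corners G1 \<union> corners G2,
      seg = (\<lambda>x. if x \<in> corners G1 then seg G1 x else seg G2 x),
      side = (\<lambda>x. if x \<in> corners G1 then side G1 x else side G2 x),
      arc = (\<lambda>x. if x \<in> corners G1 then arc G1 x else arc G2 x)
              (p := q, q := p, arc G1 p := arc G2 q, arc G2 q := arc G1 p),
      bare = bare G1 + bare G2\<rparr>"

text \<open>That \<open>G1\<close> and \<open>G2\<close> are subgraphs of \<open>G\<close> is implied by the equation: deleting
  the ribbons of the one and the vertex-discs only it contains leaves the other.\<close>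

definition prime_ribbon_graph :: "'c ribbon \<Rightarrow> bool" where
  "prime_ribbon_graph G \<longleftrightarrow> ribbon_graph G \<and>
     \<not> (\<exists>G1 G2 p q. ribbon_graph G1 \<and> ribbon_graph G2 \<and> edges G1 \<noteq> {} \<and> edges G2 \<noteq> {} \<and>
          corners G1 \<inter> corners G2 = {} \<and> p \<in> corners G1 \<and> q \<in> corners G2 \<and>
          G = join G1 p G2 q)"

definition bouquet :: "'c ribbon \<Rightarrow> bool" where
  "bouquet G \<longleftrightarrow> ribbon_graph G \<and> num_vertices G = 1"

text \<open>In a bouquet \<open>B\<close> with \<open>n\<close> loops, \<open>arc B \<circ> seg B\<close> maps a corner of a
  half-edge to the corner of the next half-edge in a fixed direction around the vertex-disc. Its
  powers \<open>0, \<dots>, 2 * n - 1\<close> applied to a corner meet each of the \<open>2 * n\<close> half-edges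
  exactly once, in cyclic order.\<close>

definition interlaced :: "'c ribbon \<Rightarrow> 'c set \<Rightarrow> 'c set \<Rightarrow> bool" where
  "interlaced B e f \<longleftrightarrow>
     (\<exists>x i j k. 0 < i \<and> i < j \<and> j < k \<and> k < 2 * card (edges B) \<and>
        x \<in> e \<and> ((arc B \<circ> seg B) ^^ i) x \<in> f \<and>
        ((arc B \<circ> seg B) ^^ j) x \<in> e \<and> ((arc B \<circ> seg B) ^^ k) x \<in> f)"

text \<open>A simple graph is a pair of a vertex set and a set of two-element sets of vertices.\<close>

type_synonym 'a sgraph = "'a set \<times> 'a set set"

definition intersection_graph :: "'c ribbon \<Rightarrow> 'c set sgraph" where
  "intersection_graph B =
     (edges B, {{e, f} | e f. e \<in> edges B \<and> f \<in> edges B \<and> e \<noteq> f \<and> interlaced B e f})"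

definition tripartition :: "'a set \<Rightarrow> 'a set \<Rightarrow> 'a set \<Rightarrow> 'a set \<Rightarrow> bool" where
  "tripartition V V1 V2 V3 \<longleftrightarrow> V = V1 \<union> V2 \<union> V3 \<and>
     V1 \<inter> V2 = {} \<and> V1 \<inter> V3 = {} \<and> V2 \<inter> V3 = {}"

text \<open>\<open>G\<close> is isomorphic to \<open>K\<^bsub>i,j,k\<^esub>\<close>; for \<open>k = 0\<close> this is the complete
  bipartite graph \<open>K\<^bsub>i,j\<^esub>\<close>.\<close>

definition is_K :: "nat \<Rightarrow> nat \<Rightarrow> nat \<Rightarrow> 'a sgraph \<Rightarrow> bool" where
  "is_K i j k G \<longleftrightarrow> i \<ge> 1 \<and> j \<ge> 1 \<and> finite (fst G) \<and>
     (\<exists>V1 V2 V3. tripartition (fst G) V1 V2 V3 \<and> card V1 = i \<and> card V2 = j \<and> card V3 = k \<and>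
        snd G = {{x, y} | x y. x \<in> V1 \<and> y \<in> V2 \<or> x \<in> V1 \<and> y \<in> V3 \<or> x \<in> V2 \<and> y \<in> V3})"

definition is_F :: "nat \<Rightarrow> nat \<Rightarrow> nat \<Rightarrow> 'a sgraph \<Rightarrow> bool" where
  "is_F i j k G \<longleftrightarrow> i \<ge> 1 \<and> k \<ge> 1 \<and> finite (fst G) \<and>
     (\<exists>V1 V2 V3. tripartition (fst G) V1 V2 V3 \<and> card V1 = i \<and> card V2 = j \<and> card V3 = k \<and>
        snd G = {{x, y} | x y. x \<noteq> y \<and>
          (x \<in> V1 \<and> y \<in> V1 \<or> x \<in> V2 \<and> y \<in> V2 \<or> x \<in> V1 \<union> V2 \<and> y \<in> V3)})"

end

theory Submission
  imports Defs "HOL-Library.Z2" "HOL-Library.Function_Algebras" "HOL-Library.FuncSet"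
begin

text \<open>Over the field with two elements, the Euler genus of a partial Petrial of a bouquet is
  the rank of the adjacency matrix of the intersection graph with a suitable zero-one diagonal.
  Twisting a loop flips its diagonal entry, so the diagonals met by the partial Petrials are all
  diagonals, and the lowest degree of the partial Petrial polynomial is the minimum rank of the
  intersection graph over that field.

The rank formula (\<open>euler_genus_rank\<close>) is proved by counting colourings of corners by
  bits. A potential is a colouring that is constant along the free arcs of the vertex-disc and
  whose jump across a ribbon does not depend on the end at which the ribbon is crossed.
  Integration along the walk around the vertex shows that a potential is the same as an arbitrary
  choice of jumps together with one free bit (\<open>jump_image\<close>,
  \<open>jump_kernel\<close>). For a fixed partial Petrial, consider the difference of a potential
  between the two corners of a side of each loop. As a function of the potential its kernel
  consists of the colourings of the faces, so its image has \<open>2 ^ \<epsilon>\<close>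
  elements, where \<open>\<epsilon>\<close> is the Euler genus (\<open>crossing_rank\<close>). As
  a function of the jumps it is given by the matrix of the intersection graph, because on the walk
  from one end of a loop to the other a second loop is passed exactly once if the two are
  interlaced, and otherwise never or twice (\<open>crossing_matrix\<close>).

It remains to find the graphs of minimum rank two. In a symmetric matrix of rank two the columns
  take at most the values \<open>0\<close>, \<open>a\<close>, \<open>b\<close> and
  \<open>a + b\<close>, an entry depends only on the classes of its row and column, and for a
  connected graph there is no zero column. The possible 3 by 3 patterns of classes are those of
  the graphs \<open>K\<close> and \<open>F\<close> (\<open>rank_2_classification\<close>). A graph
  with an induced path on three vertices never has rank below two, whereas a complete graph has
  rank one for the full diagonal; this accounts for the restrictions on the parameters. Primality
  enters through \<open>prime_connected\<close>: if the intersection graph is disconnected, a gap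
  between consecutive ends of a component is closed under the pairing of ends, and the bouquet is
  a join.\<close>

section \<open>Linear algebra over the field with two elements\<close>

declare add_bit_eq_xor [simp del] mult_bit_eq_and [simp del]

lemma bit_add_self [simp]: "(x :: bit) + x = 0"
  by (cases x) simp_all

lemma bit_fun_add_self [simp]: "(x :: 'a \<Rightarrow> bit) + x = 0"
  by (simp add: fun_eq_iff)

lemma bit_fun_add_cancel [simp]: "(x :: 'a \<Rightarrow> bit) + (x + y) = y"
  by (simp add: fun_eq_iff add.assoc [symmetric])

lemma bit_fun_add_eq_0_iff: "(x :: 'a \<Rightarrow> bit) + y = 0 \<longleftrightarrow> x = y"
  by (metis add.right_neutral bit_fun_add_cancel bit_fun_add_self)

lemma of_nat_bit: "(of_nat k :: bit) = of_bool (odd k)"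
  by (induction k) auto

lemma bit_rearrange:
  assumes "(p :: bit) + q = r + w"
  shows "q + w = p + r" "q + r = p + w"
  using assms by (cases p; cases q; cases r; cases w; simp)+

text \<open>Linear subspaces: closure under addition is enough because the only scalars are 0 and
  1.\<close>

definition additive_subset :: "('a \<Rightarrow> bit) set \<Rightarrow> bool" where
  "additive_subset H \<longleftrightarrow> finite H \<and> 0 \<in> H \<and> (\<forall>x\<in>H. \<forall>y\<in>H. x + y \<in> H)"

text \<open>The rank-nullity theorem in terms of cardinalities: every fibre is a translate of the
  kernel.\<close>

lemma card_additive_image:
  fixes h :: "('a \<Rightarrow> bit) \<Rightarrow> 'b \<Rightarrow> bit"
  assumes H: "additive_subset H" and add: "\<And>x y. x \<in> H \<Longrightarrow> y \<in> H \<Longrightarrow> h (x + y) = h x + h y"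
  shows "card H = card (h ` H) * card {x\<in>H. h x = 0}"
proof -
  have fin: "finite H" using H by (simp add: additive_subset_def)
  have cl: "x + y \<in> H" if "x \<in> H" "y \<in> H" for x y using H that by (simp add: additive_subset_def)
  have fibre: "card {x\<in>H. h x = w} = card {x\<in>H. h x = 0}" if "w \<in> h ` H" for w
  proof -
    from that obtain z where z: "z \<in> H" "w = h z" by blast
    have "bij_betw (\<lambda>x. z + x) {x\<in>H. h x = w} {x\<in>H. h x = 0}"
      by (rule bij_betwI [where g = "\<lambda>x. z + x"]) (use z cl add in auto)
    then show ?thesis by (rule bij_betw_same_card)
  qed
  have "card H = (\<Sum>w\<in>h ` H. card {x\<in>H. h x = w})"
    using sum.image_gen [OF fin, of "\<lambda>_. 1::nat" h] by simp
  also have "\<dots> = (\<Sum>w\<in>h ` H. card {x\<in>H. h x = 0})"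
    using fibre by (intro sum.cong) auto
  finally show ?thesis by simp
qed

definition vecs :: "'a set \<Rightarrow> ('a \<Rightarrow> bit) set" where
  "vecs V = {x. \<forall>i. i \<notin> V \<longrightarrow> x i = 0}"

lemma bij_betw_vecs_Pow: "bij_betw (\<lambda>x. {i. x i = 1}) (vecs V) (Pow V)"
  by (rule bij_betwI [where g = "\<lambda>S i. of_bool (i \<in> S)"])
    (auto simp: vecs_def fun_eq_iff split: if_splits)

lemma finite_vecs: "finite V \<Longrightarrow> finite (vecs V)"
  using bij_betw_finite [OF bij_betw_vecs_Pow] by blast

lemma card_vecs: "finite V \<Longrightarrow> card (vecs V) = 2 ^ card V"
  using bij_betw_same_card [OF bij_betw_vecs_Pow] by (metis card_Pow)

lemma additive_subset_vecs: "finite V \<Longrightarrow> additive_subset (vecs V)"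
  by (simp add: additive_subset_def finite_vecs) (simp add: vecs_def)

definition mat_vec :: "'a set \<Rightarrow> ('a \<Rightarrow> 'a \<Rightarrow> bit) \<Rightarrow> ('a \<Rightarrow> bit) \<Rightarrow> 'a \<Rightarrow> bit" where
  "mat_vec V M x i = (if i \<in> V then \<Sum>j\<in>V. M i j * x j else 0)"

definition col_space :: "'a set \<Rightarrow> ('a \<Rightarrow> 'a \<Rightarrow> bit) \<Rightarrow> ('a \<Rightarrow> bit) set" where
  "col_space V M = mat_vec V M ` vecs V"

definition col :: "'a set \<Rightarrow> ('a \<Rightarrow> 'a \<Rightarrow> bit) \<Rightarrow> 'a \<Rightarrow> 'a \<Rightarrow> bit" where
  "col V M j i = (if i \<in> V then M i j else 0)"

lemma mat_vec_add: "mat_vec V M (x + y) = mat_vec V M x + mat_vec V M y"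
  by (simp add: mat_vec_def fun_eq_iff distrib_left sum.distrib)

lemma additive_col_space:
  assumes "finite V"
  shows "additive_subset (col_space V M)"
proof -
  have "finite (col_space V M)" by (simp add: col_space_def finite_vecs assms)
  moreover have "mat_vec V M 0 = 0" by (simp add: mat_vec_def fun_eq_iff)
  then have "0 \<in> col_space V M" unfolding col_space_def by (force simp: vecs_def)
  moreover have "x + y \<in> col_space V M" if "x \<in> col_space V M" "y \<in> col_space V M" for x y
    using that additive_subset_vecs [OF assms]
    unfolding col_space_def additive_subset_def by (auto simp: mat_vec_add [symmetric])
  ultimately show ?thesis by (simp add: additive_subset_def)
qed

lemma col_in_col_space:
  assumes "finite V" "j \<in> V"
  shows "col V M j \<in> col_space V M"
proof -
  have "col V M j = mat_vec V M (\<lambda>i. of_bool (i = j))"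
    using assms by (auto simp: col_def mat_vec_def fun_eq_iff if_distrib cong: if_cong)
  moreover have "(\<lambda>i. of_bool (i = j)) \<in> vecs V" using assms by (auto simp: vecs_def)
  ultimately show ?thesis by (simp add: col_space_def)
qed

text \<open>An element of the column space is a sum of columns.\<close>

lemma col_space_subset:
  assumes V: "finite V" and W: "0 \<in> W" "\<And>x y. x \<in> W \<Longrightarrow> y \<in> W \<Longrightarrow> x + y \<in> W"
    and cols: "\<And>j. j \<in> V \<Longrightarrow> col V M j \<in> W"
  shows "col_space V M \<subseteq> W"
proof -
  have *: "(\<lambda>i. if i \<in> V then \<Sum>j\<in>F. M i j * x j else 0) \<in> W" if "finite F" "F \<subseteq> V" for F x
    using that
  proof (induction F)
    case empty
    have "(\<lambda>i. if i \<in> V then \<Sum>j\<in>{}. M i j * x j else 0) = 0" by (simp add: fun_eq_iff)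
    then show ?case using W(1) by (simp only:)
  next
    case (insert k F)
    let ?s = "\<lambda>i. if i \<in> V then \<Sum>j\<in>F. M i j * x j else 0"
    have "(\<lambda>i. if i \<in> V then \<Sum>j\<in>insert k F. M i j * x j else 0)
        = (if x k = 1 then col V M k else 0) + ?s"
      using insert by (auto simp: fun_eq_iff col_def)
    moreover have "\<dots> \<in> W" using insert W cols by auto
    ultimately show ?case by simp
  qed
  show ?thesis
    unfolding col_space_def using * [OF V] by (auto simp: mat_vec_def [abs_def])
qed

section \<open>Graphs of small minimum rank\<close>

definition simple_graph :: "'a sgraph \<Rightarrow> bool" where
  "simple_graph G \<longleftrightarrow> finite (fst G) \<and> snd G \<subseteq> {{x, y} | x y. x \<in> fst G \<and> y \<in> fst G \<and> x \<noteq> y}"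

definition connected_graph :: "'a sgraph \<Rightarrow> bool" where
  "connected_graph G \<longleftrightarrow>
     (\<forall>A. A \<subseteq> fst G \<and> A \<noteq> {} \<and> A \<noteq> fst G \<longrightarrow> (\<exists>x\<in>A. \<exists>y\<in>fst G - A. {x, y} \<in> snd G))"

text \<open>Looped vertices are encoded by the diagonal: \<open>D\<close> is the set of vertices
  with a loop.\<close>

definition adj_matrix :: "'a sgraph \<Rightarrow> 'a set \<Rightarrow> 'a \<Rightarrow> 'a \<Rightarrow> bit" where
  "adj_matrix G D x y = (if x = y then of_bool (x \<in> D) else of_bool ({x, y} \<in> snd G))"

abbreviation looped_col :: "'a sgraph \<Rightarrow> 'a set \<Rightarrow> 'a \<Rightarrow> 'a \<Rightarrow> bit" where
  "looped_col G D \<equiv> col (fst G) (adj_matrix G D)"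

definition looped_col_space :: "'a sgraph \<Rightarrow> 'a set \<Rightarrow> ('a \<Rightarrow> bit) set" where
  "looped_col_space G D = col_space (fst G) (adj_matrix G D)"

lemma adj_matrix_sym: "adj_matrix G D x y = adj_matrix G D y x"
  by (simp add: adj_matrix_def insert_commute)

text \<open>Edge sets in the definitions of \<open>K\<close> and \<open>F\<close> are given by an
  oriented relation \<open>R\<close>; this turns them into a condition on pairs of
  vertices.\<close>

lemma simple_graph_edges_eq:
  assumes "simple_graph G"
    and "\<And>x y. x \<in> fst G \<Longrightarrow> y \<in> fst G \<Longrightarrow> x \<noteq> y \<Longrightarrow> {x, y} \<in> snd G \<longleftrightarrow> R x y \<or> R y x"
    and "\<And>x y. R x y \<Longrightarrow> x \<in> fst G \<and> y \<in> fst G \<and> x \<noteq> y"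
  shows "snd G = {{x, y} | x y. R x y}"
proof (rule set_eqI)
  fix e
  show "e \<in> snd G \<longleftrightarrow> e \<in> {{x, y} | x y. R x y}"
  proof
    assume e: "e \<in> snd G"
    with assms(1) obtain x y where xy: "e = {x, y}" "x \<in> fst G" "y \<in> fst G" "x \<noteq> y"
      unfolding simple_graph_def by blast
    with e assms(2) [of x y] have "R x y \<or> R y x" by blast
    then show "e \<in> {{x, y} | x y. R x y}" using xy(1) by (auto simp: insert_commute)
  next
    assume "e \<in> {{x, y} | x y. R x y}"
    then show "e \<in> snd G" using assms(2,3) by blast
  qed
qed

lemma is_KI:
  assumes "simple_graph G" "tripartition (fst G) V1 V2 V3" "V1 \<noteq> {}" "V2 \<noteq> {}"
    and "\<And>x y. x \<in> fst G \<Longrightarrow> y \<in> fst G \<Longrightarrow> x \<noteq> y \<Longrightarrow> {x, y} \<in> snd G \<longleftrightarrow>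
           \<not> (x \<in> V1 \<and> y \<in> V1 \<or> x \<in> V2 \<and> y \<in> V2 \<or> x \<in> V3 \<and> y \<in> V3)"
  shows "is_K (card V1) (card V2) (card V3) G"
proof -
  let ?R = "\<lambda>x y. x \<in> V1 \<and> y \<in> V2 \<or> x \<in> V1 \<and> y \<in> V3 \<or> x \<in> V2 \<and> y \<in> V3"
  have fin: "finite (fst G)" using assms(1) by (simp add: simple_graph_def)
  then have "finite V1" "finite V2" using assms(2) by (auto simp: tripartition_def)
  then have "card V1 \<ge> 1" "card V2 \<ge> 1" using assms(3,4) by (simp_all add: Suc_le_eq card_gt_0_iff)
  moreover have "snd G = {{x, y} | x y. ?R x y}"
  proof (rule simple_graph_edges_eq [OF assms(1)])
    fix x y assume xy: "x \<in> fst G" "y \<in> fst G" "x \<noteq> y"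
    have "x \<in> V1 \<union> V2 \<union> V3" "y \<in> V1 \<union> V2 \<union> V3"
      using xy assms(2) by (simp_all add: tripartition_def)
    then show "{x, y} \<in> snd G \<longleftrightarrow> ?R x y \<or> ?R y x"
      unfolding assms(5) [OF xy] using xy(3) assms(2)
      by (elim UnE) (auto simp: tripartition_def disjoint_iff)
  qed (use assms(2) in \<open>auto simp: tripartition_def\<close>)
  ultimately show ?thesis unfolding is_K_def using fin assms(2) by blast
qed

lemma is_FI:
  assumes "simple_graph G" "tripartition (fst G) V1 V2 V3" "V1 \<noteq> {}" "V3 \<noteq> {}"
    and "\<And>x y. x \<in> fst G \<Longrightarrow> y \<in> fst G \<Longrightarrow> x \<noteq> y \<Longrightarrow> {x, y} \<in> snd G \<longleftrightarrow>
           \<not> (x \<in> V1 \<and> y \<in> V2 \<or> x \<in> V2 \<and> y \<in> V1 \<or> x \<in> V3 \<and> y \<in> V3)"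
  shows "is_F (card V1) (card V2) (card V3) G"
proof -
  let ?R = "\<lambda>x y. x \<noteq> y \<and>
     (x \<in> V1 \<and> y \<in> V1 \<or> x \<in> V2 \<and> y \<in> V2 \<or> x \<in> V1 \<union> V2 \<and> y \<in> V3)"
  have fin: "finite (fst G)" using assms(1) by (simp add: simple_graph_def)
  then have "finite V1" "finite V3" using assms(2) by (auto simp: tripartition_def)
  then have "card V1 \<ge> 1" "card V3 \<ge> 1" using assms(3,4) by (simp_all add: Suc_le_eq card_gt_0_iff)
  moreover have "snd G = {{x, y} | x y. ?R x y}"
  proof (rule simple_graph_edges_eq [OF assms(1)])
    fix x y assume xy: "x \<in> fst G" "y \<in> fst G" "x \<noteq> y"
    have "x \<in> V1 \<union> V2 \<union> V3" "y \<in> V1 \<union> V2 \<union> V3"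
      using xy assms(2) by (simp_all add: tripartition_def)
    then show "{x, y} \<in> snd G \<longleftrightarrow> ?R x y \<or> ?R y x"
      unfolding assms(5) [OF xy] using xy(3) assms(2)
      by (elim UnE) (auto simp: tripartition_def disjoint_iff)
  qed (use assms(2) in \<open>auto simp: tripartition_def\<close>)
  ultimately show ?thesis unfolding is_F_def using fin assms(2) by blast
qed

lemma is_KE:
  assumes "is_K i j k G"
  obtains V1 V2 V3 where "tripartition (fst G) V1 V2 V3" "card V1 = i" "card V2 = j" "card V3 = k"
    "\<And>x y. x \<in> fst G \<Longrightarrow> y \<in> fst G \<Longrightarrow> x \<noteq> y \<Longrightarrow> {x, y} \<in> snd G \<longleftrightarrow>
           \<not> (x \<in> V1 \<and> y \<in> V1 \<or> x \<in> V2 \<and> y \<in> V2 \<or> x \<in> V3 \<and> y \<in> V3)"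
proof -
  from assms obtain V1 V2 V3 where V: "tripartition (fst G) V1 V2 V3"
    "card V1 = i" "card V2 = j" "card V3 = k"
    and E: "snd G = {{x, y} | x y. x \<in> V1 \<and> y \<in> V2 \<or> x \<in> V1 \<and> y \<in> V3 \<or> x \<in> V2 \<and> y \<in> V3}"
    unfolding is_K_def by blast
  show thesis
  proof (rule that [OF V])
    fix x y assume "x \<in> fst G" "y \<in> fst G" "x \<noteq> y"
    then show "{x, y} \<in> snd G \<longleftrightarrow>
           \<not> (x \<in> V1 \<and> y \<in> V1 \<or> x \<in> V2 \<and> y \<in> V2 \<or> x \<in> V3 \<and> y \<in> V3)"
      using V(1) unfolding tripartition_def E by (auto simp: doubleton_eq_iff)
  qed
qed

lemma is_FE:
  assumes "is_F i j k G"
  obtains V1 V2 V3 where "tripartition (fst G) V1 V2 V3" "card V1 = i" "card V2 = j" "card V3 = k"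
    "\<And>x y. x \<in> fst G \<Longrightarrow> y \<in> fst G \<Longrightarrow> x \<noteq> y \<Longrightarrow> {x, y} \<in> snd G \<longleftrightarrow>
           \<not> (x \<in> V1 \<and> y \<in> V2 \<or> x \<in> V2 \<and> y \<in> V1 \<or> x \<in> V3 \<and> y \<in> V3)"
proof -
  from assms obtain V1 V2 V3 where V: "tripartition (fst G) V1 V2 V3"
    "card V1 = i" "card V2 = j" "card V3 = k"
    and E: "snd G = {{x, y} | x y. x \<noteq> y \<and>
          (x \<in> V1 \<and> y \<in> V1 \<or> x \<in> V2 \<and> y \<in> V2 \<or> x \<in> V1 \<union> V2 \<and> y \<in> V3)}"
    unfolding is_F_def by blast
  show thesis
  proof (rule that [OF V])
    fix x y assume "x \<in> fst G" "y \<in> fst G" "x \<noteq> y"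
    then show "{x, y} \<in> snd G \<longleftrightarrow>
           \<not> (x \<in> V1 \<and> y \<in> V2 \<or> x \<in> V2 \<and> y \<in> V1 \<or> x \<in> V3 \<and> y \<in> V3)"
      using V(1) unfolding tripartition_def E by (auto simp: doubleton_eq_iff)
  qed
qed

lemma is_K_card:
  assumes "is_K i j k G"
  shows "card (fst G) = i + j + k"
proof -
  from assms obtain V1 V2 V3 where V: "tripartition (fst G) V1 V2 V3" "finite (fst G)"
    and c: "card V1 = i" "card V2 = j" "card V3 = k"
    unfolding is_K_def by blast
  then have "finite V1" "finite V2" "finite V3" by (auto simp: tripartition_def)
  then show ?thesis
    using V c by (simp add: tripartition_def card_Un_disjoint Int_Un_distrib2)
qed

lemma card_looped_col_space_le_4:
  assumes G: "simple_graph G" and cols: "\<And>j. j \<in> fst G \<Longrightarrow> looped_col G D j \<in> {0, a, b, a + b}"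
  shows "card (looped_col_space G D) \<le> 4"
proof -
  have "finite (fst G)" using G by (simp add: simple_graph_def)
  then have "looped_col_space G D \<subseteq> {0, a, b, a + b}" unfolding looped_col_space_def
  proof (rule col_space_subset [OF _ _ _ cols])
    show "x + y \<in> {0, a, b, a + b}" if "x \<in> {0, a, b, a + b}" "y \<in> {0, a, b, a + b}" for x y
      using that by (auto simp: ac_simps)
  qed auto
  then have "card (looped_col_space G D) \<le> card {0, a, b, a + b}" by (intro card_mono) auto
  also have "\<dots> \<le> 4" by (simp add: card_insert_if)
  finally show ?thesis .
qed

text \<open>Without loops, the vertices of one part of the tripartite graph have equal columns,
  and the columns of the three parts add up to zero.\<close>

lemma is_K_col_space_le_4:
  assumes "simple_graph G" "is_K i j k G"
  shows "card (looped_col_space G {}) \<le> 4"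
  using assms(2)
proof (rule is_KE)
  fix V1 V2 V3
  assume T: "tripartition (fst G) V1 V2 V3" and
    E: "\<And>x y. x \<in> fst G \<Longrightarrow> y \<in> fst G \<Longrightarrow> x \<noteq> y \<Longrightarrow> {x, y} \<in> snd G \<longleftrightarrow>
           \<not> (x \<in> V1 \<and> y \<in> V1 \<or> x \<in> V2 \<and> y \<in> V2 \<or> x \<in> V3 \<and> y \<in> V3)"
  let ?a = "\<lambda>x. of_bool (x \<in> V2 \<union> V3) :: bit" and ?b = "\<lambda>x. of_bool (x \<in> V1 \<union> V3) :: bit"
  show ?thesis
  proof (rule card_looped_col_space_le_4 [OF assms(1), where a = ?a and b = ?b])
    fix j assume j: "j \<in> fst G"
    have col: "looped_col G {} j = (\<lambda>x. of_bool (x \<in> V1 \<union> V2 \<union> V3 \<and>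
        \<not> (x \<in> V1 \<and> j \<in> V1 \<or> x \<in> V2 \<and> j \<in> V2 \<or> x \<in> V3 \<and> j \<in> V3)))"
    proof
      fix x
      show "looped_col G {} j x = of_bool (x \<in> V1 \<union> V2 \<union> V3 \<and>
        \<not> (x \<in> V1 \<and> j \<in> V1 \<or> x \<in> V2 \<and> j \<in> V2 \<or> x \<in> V3 \<and> j \<in> V3))"
        using E [of x j] j T by (auto simp: col_def adj_matrix_def tripartition_def disjoint_iff)
    qed
    have "j \<in> V1 \<union> V2 \<union> V3" using j T by (simp add: tripartition_def)
    then consider "j \<in> V1" "j \<notin> V2" "j \<notin> V3" | "j \<notin> V1" "j \<in> V2" "j \<notin> V3"
      | "j \<notin> V1" "j \<notin> V2" "j \<in> V3"
      using T by (auto simp: tripartition_def disjoint_iff)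
    then show "looped_col G {} j \<in> {0, ?a, ?b, ?a + ?b}"
    proof cases
      case 1
      then have "looped_col G {} j = ?a" unfolding col using T by (auto simp: tripartition_def fun_eq_iff disjoint_iff)
      then show ?thesis by simp
    next
      case 2
      then have "looped_col G {} j = ?b" unfolding col using T by (auto simp: tripartition_def fun_eq_iff disjoint_iff)
      then show ?thesis by simp
    next
      case 3
      then have "looped_col G {} j = ?a + ?b"
        unfolding col using T by (auto simp: tripartition_def fun_eq_iff disjoint_iff)
      then show ?thesis by simp
    qed
  qed
qed

text \<open>With loops at the vertices of the two cliques, the vertices of one part have equal
  columns, and a column of the independent part is the sum of the columns of the cliques.\<close>

lemma is_F_col_space_le_4:
  assumes "simple_graph G" "is_F i j k G"
  shows "\<exists>D\<subseteq>fst G. card (looped_col_space G D) \<le> 4"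
  using assms(2)
proof (rule is_FE)
  fix V1 V2 V3
  assume T: "tripartition (fst G) V1 V2 V3" and
    E: "\<And>x y. x \<in> fst G \<Longrightarrow> y \<in> fst G \<Longrightarrow> x \<noteq> y \<Longrightarrow> {x, y} \<in> snd G \<longleftrightarrow>
           \<not> (x \<in> V1 \<and> y \<in> V2 \<or> x \<in> V2 \<and> y \<in> V1 \<or> x \<in> V3 \<and> y \<in> V3)"
  let ?D = "V1 \<union> V2"
  let ?a = "\<lambda>x. of_bool (x \<in> V1 \<union> V3) :: bit" and ?b = "\<lambda>x. of_bool (x \<in> V2 \<union> V3) :: bit"
  have "card (looped_col_space G ?D) \<le> 4"
  proof (rule card_looped_col_space_le_4 [OF assms(1), where a = ?a and b = ?b])
    fix j assume j: "j \<in> fst G"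
    have col: "looped_col G ?D j = (\<lambda>x. of_bool (x \<in> V1 \<union> V2 \<union> V3 \<and>
        \<not> (x \<in> V1 \<and> j \<in> V2 \<or> x \<in> V2 \<and> j \<in> V1 \<or> x \<in> V3 \<and> j \<in> V3)))"
    proof
      fix x
      show "looped_col G ?D j x = of_bool (x \<in> V1 \<union> V2 \<union> V3 \<and>
        \<not> (x \<in> V1 \<and> j \<in> V2 \<or> x \<in> V2 \<and> j \<in> V1 \<or> x \<in> V3 \<and> j \<in> V3))"
        using E [of x j] j T by (auto simp: col_def adj_matrix_def tripartition_def disjoint_iff)
    qed
    have "j \<in> V1 \<union> V2 \<union> V3" using j T by (simp add: tripartition_def)
    then consider "j \<in> V1" "j \<notin> V2" "j \<notin> V3" | "j \<notin> V1" "j \<in> V2" "j \<notin> V3"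
      | "j \<notin> V1" "j \<notin> V2" "j \<in> V3"
      using T by (auto simp: tripartition_def disjoint_iff)
    then show "looped_col G ?D j \<in> {0, ?a, ?b, ?a + ?b}"
    proof cases
      case 1
      then have "looped_col G ?D j = ?a" unfolding col using T by (auto simp: tripartition_def fun_eq_iff disjoint_iff)
      then show ?thesis by simp
    next
      case 2
      then have "looped_col G ?D j = ?b" unfolding col using T by (auto simp: tripartition_def fun_eq_iff disjoint_iff)
      then show ?thesis by simp
    next
      case 3
      then have "looped_col G ?D j = ?a + ?b"
        unfolding col using T by (auto simp: tripartition_def fun_eq_iff disjoint_iff)
      then show ?thesis by simp
    qed
  qed
  then show ?thesis using T unfolding tripartition_def by (intro exI [of _ ?D]) auto
qed

text \<open>The columns of one end \<open>u\<close> and of the middle \<open>w\<close> are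
  non-zero, and the other end \<open>v\<close> tells them apart, whatever the diagonal is.\<close>

lemma induced_path_col_space_gt_2:
  assumes G: "simple_graph G" and uvw: "u \<in> fst G" "v \<in> fst G" "w \<in> fst G" "u \<noteq> v"
    and E: "{u, w} \<in> snd G" "{v, w} \<in> snd G" "{u, v} \<notin> snd G"
  shows "card (looped_col_space G D) > 2"
proof -
  let ?m = "looped_col G D" and ?W = "looped_col_space G D"
  have fin: "finite (fst G)" using G by (simp add: simple_graph_def)
  have ne: "u \<noteq> w" "v \<noteq> w" using G E unfolding simple_graph_def by fastforce+
  have *: "0 \<in> ?W" "?m u \<in> ?W" "?m w \<in> ?W" "finite ?W"
    using additive_col_space [OF fin] col_in_col_space [OF fin] uvw
    by (auto simp: additive_subset_def looped_col_space_def)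
  have "?m u w = 1" "?m w v = 1" "?m w u = 1" "?m u v = 0"
    using E uvw ne by (auto simp: col_def adj_matrix_def insert_commute)
  then have "?m u \<noteq> 0" "?m w \<noteq> 0" "?m u \<noteq> ?m w" by auto
  then have "card {0, ?m u, ?m w} = 3" by auto
  moreover have "card {0, ?m u, ?m w} \<le> card ?W" using * by (intro card_mono) auto
  ultimately show ?thesis by simp
qed

lemma is_K_induced_path:
  assumes "is_K i j k G" "i + j \<ge> 3"
  shows "\<exists>u\<in>fst G. \<exists>v\<in>fst G. \<exists>w\<in>fst G. u \<noteq> v \<and> {u, w} \<in> snd G \<and> {v, w} \<in> snd G \<and> {u, v} \<notin> snd G"
  using assms(1)
proof (rule is_KE)
  fix V1 V2 V3
  assume T: "tripartition (fst G) V1 V2 V3" and c: "card V1 = i" "card V2 = j" and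
    E: "\<And>x y. x \<in> fst G \<Longrightarrow> y \<in> fst G \<Longrightarrow> x \<noteq> y \<Longrightarrow> {x, y} \<in> snd G \<longleftrightarrow>
           \<not> (x \<in> V1 \<and> y \<in> V1 \<or> x \<in> V2 \<and> y \<in> V2 \<or> x \<in> V3 \<and> y \<in> V3)"
  have ij: "i \<ge> 1" "j \<ge> 1" using assms(1) by (auto simp: is_K_def)
  consider "i \<ge> 2" | "j \<ge> 2" using assms(2) by linarith
  then obtain u v w where obt: "u \<noteq> v" "u \<in> V1 \<and> v \<in> V1 \<and> w \<in> V2 \<or> u \<in> V2 \<and> v \<in> V2 \<and> w \<in> V1"
  proof cases
    case 1
    then obtain u v where "u \<in> V1" "v \<in> V1" "u \<noteq> v" using c(1) by (metis card_le_Suc0_iff_eq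
      card.infinite not_less_eq_eq numeral_2_eq_2 zero_le)
    moreover obtain w where "w \<in> V2" using ij(2) c(2) by fastforce
    ultimately show ?thesis using that by blast
  next
    case 2
    then obtain u v where "u \<in> V2" "v \<in> V2" "u \<noteq> v" using c(2) by (metis card_le_Suc0_iff_eq
      card.infinite not_less_eq_eq numeral_2_eq_2 zero_le)
    moreover obtain w where "w \<in> V1" using ij(1) c(1) by fastforce
    ultimately show ?thesis using that by blast
  qed
  then have uvw: "u \<in> fst G" "v \<in> fst G" "w \<in> fst G" "u \<noteq> v" "u \<noteq> w" "v \<noteq> w"
    using T by (auto simp: tripartition_def disjoint_iff)
  have "{u, w} \<in> snd G" "{v, w} \<in> snd G" "{u, v} \<notin> snd G"
    unfolding E [OF uvw(1,3,5)] E [OF uvw(2,3,6)] E [OF uvw(1,2,4)]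
    using obt T by (auto simp: tripartition_def disjoint_iff)
  with uvw show ?thesis
    by - (rule bexI [of _ u], rule bexI [of _ v], rule bexI [of _ w], simp_all)
qed

lemma is_F_induced_path:
  assumes "is_F i j k G" "j \<noteq> 0 \<or> k \<ge> 2"
  shows "\<exists>u\<in>fst G. \<exists>v\<in>fst G. \<exists>w\<in>fst G. u \<noteq> v \<and> {u, w} \<in> snd G \<and> {v, w} \<in> snd G \<and> {u, v} \<notin> snd G"
  using assms(1)
proof (rule is_FE)
  fix V1 V2 V3
  assume T: "tripartition (fst G) V1 V2 V3" and c: "card V1 = i" "card V2 = j" "card V3 = k" and
    E: "\<And>x y. x \<in> fst G \<Longrightarrow> y \<in> fst G \<Longrightarrow> x \<noteq> y \<Longrightarrow> {x, y} \<in> snd G \<longleftrightarrow>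
           \<not> (x \<in> V1 \<and> y \<in> V2 \<or> x \<in> V2 \<and> y \<in> V1 \<or> x \<in> V3 \<and> y \<in> V3)"
  have "i \<ge> 1" "k \<ge> 1" using assms(1) by (auto simp: is_F_def)
  then obtain x z where x: "x \<in> V1" and z: "z \<in> V3" using c by fastforce
  from assms(2)
  obtain u v w where obt: "u \<noteq> v" "u \<in> V1 \<and> v \<in> V2 \<and> w \<in> V3 \<or> u \<in> V3 \<and> v \<in> V3 \<and> w \<in> V1"
  proof
    assume "j \<noteq> 0"
    then obtain y where "y \<in> V2" using c(2) by fastforce
    then show ?thesis using T x z that [of x y z] unfolding tripartition_def by blast
  next
    assume "k \<ge> 2"
    then obtain u v where "u \<in> V3" "v \<in> V3" "u \<noteq> v" using c(3) by (metis card_le_Suc0_iff_eq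
      card.infinite not_less_eq_eq numeral_2_eq_2 zero_le)
    then show ?thesis using that x by blast
  qed
  then have uvw: "u \<in> fst G" "v \<in> fst G" "w \<in> fst G" "u \<noteq> v" "u \<noteq> w" "v \<noteq> w"
    using T by (auto simp: tripartition_def disjoint_iff)
  have "{u, w} \<in> snd G" "{v, w} \<in> snd G" "{u, v} \<notin> snd G"
    unfolding E [OF uvw(1,3,5)] E [OF uvw(2,3,6)] E [OF uvw(1,2,4)]
    using obt T by (auto simp: tripartition_def disjoint_iff)
  with uvw show ?thesis
    by - (rule bexI [of _ u], rule bexI [of _ v], rule bexI [of _ w], simp_all)
qed

text \<open>With a loop at every vertex all entries of the matrix are equal to 1.\<close>

lemma complete_graph_col_space_le_2:
  assumes G: "simple_graph G"
    and E: "\<And>x y. x \<in> fst G \<Longrightarrow> y \<in> fst G \<Longrightarrow> x \<noteq> y \<Longrightarrow> {x, y} \<in> snd G"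
  shows "card (looped_col_space G (fst G)) \<le> 2"
proof -
  let ?a = "\<lambda>x. of_bool (x \<in> fst G) :: bit"
  have "finite (fst G)" using G by (simp add: simple_graph_def)
  then have "looped_col_space G (fst G) \<subseteq> {0, ?a}" unfolding looped_col_space_def
  proof (rule col_space_subset)
    show "looped_col G (fst G) j \<in> {0, ?a}" if "j \<in> fst G" for j
      using E that by (auto simp: col_def adj_matrix_def fun_eq_iff)
  qed auto
  then have "card (looped_col_space G (fst G)) \<le> card {0, ?a}" by (intro card_mono) auto
  also have "\<dots> \<le> 2" by (simp add: card_insert_if)
  finally show ?thesis .
qed

text \<open>The vertices are classified by their columns \<open>a\<close>, \<open>b\<close> and
  \<open>a + b\<close>. By symmetry each column is constant on the classes, so the matrix is
  determined by the entries \<open>p\<close>, \<open>q\<close>, \<open>r\<close> at the classes of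
  \<open>a\<close> and \<open>b\<close>, and four of the eight values of \<open>(p, q, r)\<close>
  are left since \<open>a\<close> and \<open>b\<close> are distinct and non-zero. Taking for
  \<open>a\<close> the column of a vertex \<open>u\<close> that has a non-neighbour
  \<open>v\<close> makes the restrictions on the part sizes come out directly: the class of
  \<open>v\<close> is then known whenever it matters.\<close>

theorem rank_2_classification:
  assumes G: "simple_graph G" and conn: "connected_graph G"
    and uv: "u \<in> fst G" "v \<in> fst G" "u \<noteq> v" "{u, v} \<notin> snd G"
    and rank: "card (looped_col_space G D) = 4"
  shows "(\<exists>i j k. is_K i j k G \<and> (k = 0 \<or> (i + j \<ge> 3 \<and> k \<noteq> 0))) \<or>
    (\<exists>i j k. is_F i j k G \<and> (j \<noteq> 0 \<or> (j = 0 \<and> k \<ge> 2)))"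
proof -
  let ?V = "fst G" and ?W = "looped_col_space G D" and ?m = "looped_col G D"
  have fin: "finite ?V" using G by (simp add: simple_graph_def)
  have W: "finite ?W" "0 \<in> ?W" "\<And>x y. x \<in> ?W \<Longrightarrow> y \<in> ?W \<Longrightarrow> x + y \<in> ?W"
    using additive_col_space [OF fin, of "adj_matrix G D"]
    by (auto simp: additive_subset_def looped_col_space_def)
  have m_in: "?m x \<in> ?W" if "x \<in> ?V" for x
    using col_in_col_space [OF fin that] by (simp add: looped_col_space_def)
  have edge: "{x, y} \<in> snd G \<longleftrightarrow> ?m x y = 1" if "x \<in> ?V" "y \<in> ?V" "x \<noteq> y" for x y
    using that by (auto simp: col_def adj_matrix_def insert_commute)
  have sym: "?m x y = ?m y x" if "x \<in> ?V" "y \<in> ?V" for x y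
    using that by (simp add: col_def adj_matrix_sym)
  have outside: "?m x y = 0" if "y \<notin> ?V" for x y using that by (simp add: col_def)
  have crossing: "\<exists>x\<in>A. \<exists>y\<in>?V - A. {x, y} \<in> snd G" if "A \<subseteq> ?V" "A \<noteq> {}" "A \<noteq> ?V" for A
    using conn that unfolding connected_graph_def by blast
  \<comment> \<open>Isolated vertices are excluded by connectedness.\<close>
  have nz: "?m x \<noteq> 0" if x: "x \<in> ?V" for x
  proof -
    have "{x} \<noteq> ?V" using uv(1-3) by (metis singletonD)
    then obtain y where y: "y \<in> ?V - {x}" "{x, y} \<in> snd G" using crossing [of "{x}"] x by blast
    then have "?m x y = 1" using edge [of x y] x by blast
    then show ?thesis by auto
  qed
  \<comment> \<open>Equal columns throughout would span a space of two elements only.\<close>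
  obtain w where w: "w \<in> ?V" "?m w \<noteq> ?m u"
  proof (rule ccontr)
    assume "\<not> thesis"
    with that have eq: "?m x = ?m u" if "x \<in> ?V" for x using that by blast
    have "?W \<subseteq> {0, ?m u}" unfolding looped_col_space_def
      by (rule col_space_subset [OF fin]) (use eq in auto)
    then have "card ?W \<le> card {0, ?m u}" by (intro card_mono) auto
    also have "\<dots> \<le> 2" by (simp add: card_insert_if)
    finally show False using rank by simp
  qed
  define a b where "a = ?m u" and "b = ?m w"
  have ab: "a \<noteq> 0" "b \<noteq> 0" "a \<noteq> b" using nz uv(1) w by (auto simp: a_def b_def)
  have "a + b \<noteq> 0" using ab(3) by (simp add: bit_fun_add_eq_0_iff)
  then have "card {0, a, b, a + b} = 4" using ab by simp
  moreover have "{0, a, b, a + b} \<subseteq> ?W"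
    using W m_in [OF uv(1)] m_in [OF w(1)] unfolding a_def b_def by blast
  ultimately have W_eq: "?W = {0, a, b, a + b}"
    using W(1) rank by (metis card_subset_eq)
  define Va Vb Vc where "Va = {x\<in>?V. ?m x = a}" and "Vb = {x\<in>?V. ?m x = b}"
    and "Vc = {x\<in>?V. ?m x = a + b}"
  have "x \<in> Va \<union> Vb \<union> Vc" if "x \<in> ?V" for x
    using m_in [OF that] nz [OF that] that unfolding W_eq Va_def Vb_def Vc_def by blast
  then have V_eq: "?V = Va \<union> Vb \<union> Vc" unfolding Va_def Vb_def Vc_def by blast
  have dis: "Va \<inter> Vb = {}" "Va \<inter> Vc = {}" "Vb \<inter> Vc = {}"
    using ab unfolding Va_def Vb_def Vc_def by auto
  have u_Va: "u \<in> Va" and w_Vb: "w \<in> Vb" using uv w by (simp_all add: Va_def Vb_def a_def b_def)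
  define p q r where "p = a u" and "q = a w" and "r = b w"
  have q': "b u = q" using sym [OF uv(1) w(1)] by (simp add: q_def a_def b_def)
  have a_x: "a x = ?m x u" and b_x: "b x = ?m x w" if "x \<in> ?V" for x
    using sym uv w that by (simp_all add: a_def b_def)
  have ta: "x \<in> Va \<Longrightarrow> a x = p" "x \<in> Vb \<Longrightarrow> a x = q" "x \<in> Vc \<Longrightarrow> a x = p + q"
    and tb: "x \<in> Va \<Longrightarrow> b x = q" "x \<in> Vb \<Longrightarrow> b x = r" "x \<in> Vc \<Longrightarrow> b x = q + r" for x
    using a_x b_x by (simp_all add: Va_def Vb_def Vc_def p_def q_def r_def q' [unfolded q_def])
  have ea: "x \<in> Va \<Longrightarrow> ?m x = a" and eb: "x \<in> Vb \<Longrightarrow> ?m x = b" and ec: "x \<in> Vc \<Longrightarrow> ?m x = a + b" for x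
    by (simp_all add: Va_def Vb_def Vc_def)
  have a0: "a = 0" if "p = 0" "q = 0"
  proof
    fix x show "a x = 0 x"
      using that ta outside [of x u] V_eq by (cases "x \<in> ?V") (auto simp: a_def)
  qed
  have b0: "b = 0" if "q = 0" "r = 0"
  proof
    fix x show "b x = 0 x"
      using that tb outside [of x w] V_eq by (cases "x \<in> ?V") (auto simp: b_def)
  qed
  have a_eq_b: "a = b" if "p = q" "q = r"
  proof
    fix x show "a x = b x"
      using that ta tb outside [of x u] outside [of x w] V_eq
      by (cases "x \<in> ?V") (auto simp: a_def b_def)
  qed
  have av: "a v = 0" using edge [OF uv(1-3)] uv(4) by (simp add: a_def)
  have v_cases: "v \<in> Va \<or> v \<in> Vb \<or> v \<in> Vc" using uv(2) V_eq by blast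
  have finV: "finite Va" "finite Vb" "finite Vc" using fin by (simp_all add: V_eq)
  have adj_cases: "{x, y} \<in> snd G \<longleftrightarrow>
      (x \<in> Va \<and> y \<in> Va \<and> p = 1) \<or> (x \<in> Va \<and> y \<in> Vb \<and> q = 1) \<or> (x \<in> Va \<and> y \<in> Vc \<and> p + q = 1) \<or>
      (x \<in> Vb \<and> y \<in> Va \<and> q = 1) \<or> (x \<in> Vb \<and> y \<in> Vb \<and> r = 1) \<or> (x \<in> Vb \<and> y \<in> Vc \<and> q + r = 1) \<or>
      (x \<in> Vc \<and> y \<in> Va \<and> p + q = 1) \<or> (x \<in> Vc \<and> y \<in> Vb \<and> q + r = 1) \<or> (x \<in> Vc \<and> y \<in> Vc \<and> p + r = 1)"
    if "x \<in> ?V" "y \<in> ?V" "x \<noteq> y" for x y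
  proof -
    have pr: "p + q + (q + r) = p + r" by (cases q) (simp_all add: ac_simps)
    have x: "x \<in> Va \<and> x \<notin> Vb \<and> x \<notin> Vc \<or> x \<notin> Va \<and> x \<in> Vb \<and> x \<notin> Vc \<or>
        x \<notin> Va \<and> x \<notin> Vb \<and> x \<in> Vc"
      using that(1) V_eq dis by blast
    have y: "y \<in> Va \<and> y \<notin> Vb \<and> y \<notin> Vc \<or> y \<notin> Va \<and> y \<in> Vb \<and> y \<notin> Vc \<or>
        y \<notin> Va \<and> y \<notin> Vb \<and> y \<in> Vc"
      using that(2) V_eq dis by blast
    show ?thesis
      unfolding edge [OF that] using x y by (elim disjE) (simp_all add: ta tb ea eb ec pr)
  qed
  have tri: "tripartition ?V Va Vb Vc" "tripartition ?V Va Vc Vb" "tripartition ?V Vb Vc Va"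
    unfolding tripartition_def using V_eq dis by auto
  have two: "card Va \<ge> 2" if "v \<in> Va"
    using card_mono [OF finV(1), of "{u, v}"] uv(3) u_Va that by simp
  show ?thesis
  proof (cases "q = 0")
    case 0: True
    then have pr: "p = 1" "r = 1" using a0 b0 ab by (metis bit_not_zero_iff)+
    \<comment> \<open>Two disjoint cliques, joined by the third class because the graph is
      connected.\<close>
    have "Va \<noteq> ?V" using w_Vb dis V_eq by blast
    then obtain x y where xy: "x \<in> Va" "y \<in> ?V - Va" "{x, y} \<in> snd G"
      using crossing [of Va] u_Va V_eq by blast
    then have "y \<in> Vc" using adj_cases [of x y] 0 V_eq dis by auto
    then have "is_F (card Va) (card Vb) (card Vc) G"
      using u_Va 0 pr V_eq dis by (intro is_FI [OF G tri(1)]) (auto simp: adj_cases)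
    moreover have "card Vb \<noteq> 0" using w_Vb finV by auto
    ultimately show ?thesis by blast
  next
    case False
    then have q: "q = 1" by simp
    consider "p = 0" "r = 0" | "p = 1" "r = 0" | "p = 0" "r = 1"
      using a_eq_b ab(3) q by (cases p; cases r) auto
    then show ?thesis
    proof cases
      case 1
      then have "v \<in> Va" using av v_cases q ta by auto
      moreover have "is_K (card Va) (card Vb) (card Vc) G"
        using u_Va w_Vb 1 q V_eq dis by (intro is_KI [OF G tri(1)]) (auto simp: adj_cases)
      moreover have "card Vb \<ge> 1" using calculation(2) by (simp add: is_K_def)
      ultimately have "is_K (card Va) (card Vb) (card Vc) G" "card Va + card Vb \<ge> 3"
        using two by auto
      then show ?thesis by blast
    next
      case 2
      then have "v \<in> Vc" using av v_cases q ta by auto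
      then have "card Vc \<noteq> 0" using finV by auto
      moreover have "is_F (card Va) (card Vc) (card Vb) G"
        using u_Va w_Vb 2 q V_eq dis by (intro is_FI [OF G tri(2)]) (auto simp: adj_cases)
      ultimately show ?thesis by blast
    next
      case 3
      then have "v \<in> Va" using av v_cases q ta by auto
      moreover have "is_F (card Vb) (card Vc) (card Va) G"
        using u_Va w_Vb 3 q V_eq dis by (intro is_FI [OF G tri(3)]) (auto simp: adj_cases)
      ultimately show ?thesis using two by blast
    qed
  qed
qed

section \<open>Orbits of pairings\<close>

lemma pairingD:
  assumes "pairing C f" "x \<in> C"
  shows "f x \<in> C" "f x \<noteq> x" "f (f x) = x"
  using assms by (auto simp: pairing_def)

definition steps :: "'c set \<Rightarrow> ('c \<Rightarrow> 'c) set \<Rightarrow> ('c \<times> 'c) set" where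
  "steps C S = {(x, f x) | x f. x \<in> C \<and> f \<in> S}"

lemma orbits_eq: "orbits C S = (\<lambda>x. (steps C S)\<^sup>* `` {x}) ` C"
  by (auto simp: orbits_def quotient_def steps_def)

lemma stepsI: "x \<in> C \<Longrightarrow> f \<in> S \<Longrightarrow> (x, f x) \<in> steps C S"
  by (auto simp: steps_def)

lemma stepsE:
  assumes "(x, y) \<in> steps C S"
  obtains f where "x \<in> C" "f \<in> S" "y = f x"
  using assms by (auto simp: steps_def)

lemma steps_sym:
  assumes "\<And>f. f \<in> S \<Longrightarrow> pairing C f" "(x, y) \<in> (steps C S)\<^sup>*"
  shows "(y, x) \<in> (steps C S)\<^sup>*"
proof -
  have "sym (steps C S)"
  proof (rule symI)
    fix x y assume "(x, y) \<in> steps C S"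
    then obtain f where f: "x \<in> C" "f \<in> S" "y = f x" by (rule stepsE)
    then have "y \<in> C" "f y = x" using pairingD [OF assms(1)] by simp_all
    then show "(y, x) \<in> steps C S" using f(2) stepsI [of y C f S] by simp
  qed
  then have "sym ((steps C S)\<^sup>*)" by (rule sym_rtrancl)
  then show ?thesis using assms(2) by (rule symD)
qed

lemma steps_in:
  assumes "\<And>f. f \<in> S \<Longrightarrow> pairing C f" "(x, y) \<in> (steps C S)\<^sup>*" "x \<in> C"
  shows "y \<in> C"
  using assms(2)
proof (induction rule: rtrancl_induct)
  case (step y z)
  then obtain f where "y \<in> C" "f \<in> S" "z = f y" by (auto elim: stepsE)
  then show ?case using pairingD(1) [OF assms(1)] by blast
qed (rule assms(3))

text \<open>An invariant function is an independent choice of a bit for each orbit. With the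
  pairings side and arc the orbits are the faces.\<close>

lemma card_invariant_functions:
  assumes C: "finite C" and S: "\<And>f. f \<in> S \<Longrightarrow> pairing C f"
  shows "card {c \<in> vecs C. \<forall>f\<in>S. \<forall>x\<in>C. c (f x) = c x} = 2 ^ card (orbits C S)"
proof -
  let ?I = "{c \<in> vecs C. \<forall>f\<in>S. \<forall>x\<in>C. c (f x) = c x}" and ?r = "(steps C S)\<^sup>*"
  have const: "c y = c x" if "c \<in> ?I" "(x, y) \<in> ?r" for c x y
    using that(2) by (induction rule: rtrancl_induct) (use that(1) in \<open>auto elim!: stepsE\<close>)
  have cover: "x \<in> ?r `` {x}" "?r `` {x} \<in> orbits C S" if "x \<in> C" for x
    using that by (auto simp: orbits_eq)
  have orbit_eq: "q = ?r `` {x}" if "q \<in> orbits C S" "x \<in> q" for q x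
    using that steps_sym [OF S] by (auto simp: orbits_eq dest: rtrancl_trans)
  have sub: "q \<subseteq> C" if "q \<in> orbits C S" for q
    using that steps_in [OF S] by (auto simp: orbits_eq)
  have ne: "q \<noteq> {}" if "q \<in> orbits C S" for q
    using that by (auto simp: orbits_eq)
  have "bij_betw (\<lambda>Q x. of_bool (x \<in> \<Union>Q)) (Pow (orbits C S)) ?I"
  proof (rule bij_betwI [where g = "\<lambda>c. {q \<in> orbits C S. \<forall>x\<in>q. c x = 1}"])
    show "(\<lambda>Q x. of_bool (x \<in> \<Union>Q)) \<in> Pow (orbits C S) \<rightarrow> ?I"
    proof
      fix Q assume Q: "Q \<in> Pow (orbits C S)"
      have "f x \<in> \<Union>Q \<longleftrightarrow> x \<in> \<Union>Q" if "f \<in> S" "x \<in> C" for f x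
      proof -
        have 1: "(x, f x) \<in> ?r" using that by (blast intro: stepsI)
        then have "(f x, x) \<in> ?r" using steps_sym [OF S] by blast
        with 1 show ?thesis using Q orbit_eq by blast
      qed
      moreover have "x \<notin> \<Union>Q" if "x \<notin> C" for x using that sub Q by blast
      ultimately show "(\<lambda>x. of_bool (x \<in> \<Union>Q)) \<in> ?I" by (simp add: vecs_def)
    qed
    show "{q \<in> orbits C S. \<forall>x\<in>q. of_bool (x \<in> \<Union>Q) = (1 :: bit)} = Q"
      if Q: "Q \<in> Pow (orbits C S)" for Q
    proof (rule set_eqI)
      fix q
      show "q \<in> {q \<in> orbits C S. \<forall>x\<in>q. of_bool (x \<in> \<Union>Q) = (1 :: bit)} \<longleftrightarrow> q \<in> Q"
      proof
        assume q: "q \<in> {q \<in> orbits C S. \<forall>x\<in>q. of_bool (x \<in> \<Union>Q) = (1 :: bit)}"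
        then obtain x where "x \<in> q" using ne by blast
        with q obtain q' where "q' \<in> Q" "x \<in> q'" by auto
        then have "q' = q" using q Q \<open>x \<in> q\<close> orbit_eq by blast
        then show "q \<in> Q" using \<open>q' \<in> Q\<close> by simp
      qed (use Q in auto)
    qed
    show "(\<lambda>x. of_bool (x \<in> \<Union>{q \<in> orbits C S. \<forall>x\<in>q. c x = 1})) = c" if c: "c \<in> ?I" for c
    proof
      fix x
      have "x \<in> \<Union>{q \<in> orbits C S. \<forall>x\<in>q. c x = 1} \<longleftrightarrow> c x = 1"
      proof
        assume 1: "c x = 1"
        then have "x \<in> C" using c by (auto simp: vecs_def)
        then show "x \<in> \<Union>{q \<in> orbits C S. \<forall>x\<in>q. c x = 1}"
          using cover [of x] const [OF c, of x] 1 by (intro UnionI [of "?r `` {x}"]) simp_all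
      qed blast
      then show "of_bool (x \<in> \<Union>{q \<in> orbits C S. \<forall>x\<in>q. c x = 1}) = c x" by simp
    qed
  qed auto
  then have "card ?I = card (Pow (orbits C S))" by (rule bij_betw_same_card [symmetric])
  also have "\<dots> = 2 ^ card (orbits C S)"
    using C by (intro card_Pow) (simp add: orbits_eq)
  finally show ?thesis .
qed

section \<open>The walk around the vertex of a bouquet\<close>

text \<open>With at least one loop present, the single vertex-disc is not a bare one and all
  corners lie on it.\<close>

locale looped_bouquet =
  fixes B :: "'c ribbon"
  assumes bouquet: "bouquet B" and nonempty: "corners B \<noteq> {}"
begin

abbreviation "C \<equiv> corners B"
abbreviation "s \<equiv> seg B"
abbreviation "t \<equiv> side B"
abbreviation "a \<equiv> arc B"

text \<open>One step around the vertex-disc: across the end of a ribbon and along the next free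
  arc.\<close>

definition walk :: "'c \<Rightarrow> 'c" where
  "walk = arc B \<circ> seg B"

lemma walk_apply: "walk x = a (s x)"
  by (simp add: walk_def)

lemma pairings: "pairing C s" "pairing C t" "pairing C a"
  and finite_corners: "finite C"
  using bouquet by (auto simp: bouquet_def ribbon_graph_def)

lemma outside [simp]: "x \<notin> C \<Longrightarrow> s x = x" "x \<notin> C \<Longrightarrow> t x = x" "x \<notin> C \<Longrightarrow> a x = x"
  using pairings by (auto simp: pairing_def)

lemma involution [simp]: "s (s x) = x" "t (t x) = x" "a (a x) = x"
  using pairingD(3) [OF pairings(1)] pairingD(3) [OF pairings(2)] pairingD(3) [OF pairings(3)]
  by (cases "x \<in> C"; simp)+

lemma closed [simp]: "x \<in> C \<Longrightarrow> s x \<in> C" "x \<in> C \<Longrightarrow> t x \<in> C" "x \<in> C \<Longrightarrow> a x \<in> C"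
  using pairings pairingD(1) by metis+

lemma fixpoint_free [simp]: "x \<in> C \<Longrightarrow> s x \<noteq> x" "x \<in> C \<Longrightarrow> t x \<noteq> x" "x \<in> C \<Longrightarrow> a x \<noteq> x"
  using pairings pairingD(2) by metis+

lemma side_seg: "t (s x) = s (t x)"
  using bouquet by (cases "x \<in> C") (auto simp: bouquet_def ribbon_graph_def)

lemma side_ne_seg [simp]: "x \<in> C \<Longrightarrow> t x \<noteq> s x" "x \<in> C \<Longrightarrow> s x \<noteq> t x" "x \<in> C \<Longrightarrow> s (t x) \<noteq> x"
  using bouquet by (auto simp: bouquet_def ribbon_graph_def) (metis involution(1))

definition edge_of :: "'c \<Rightarrow> 'c set" where
  "edge_of x = {x, s x, t x, s (t x)}"

lemma edge_of_self [simp]: "x \<in> edge_of x"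
  by (simp add: edge_of_def)

lemma edge_of_step [simp]: "edge_of (s x) = edge_of x" "edge_of (t x) = edge_of x"
  by (auto simp: edge_of_def side_seg)

lemma edge_of_eq: "y \<in> edge_of x \<Longrightarrow> edge_of y = edge_of x"
  by (auto simp: edge_of_def side_seg)

lemma edge_of_subset: "x \<in> C \<Longrightarrow> edge_of x \<subseteq> C"
  by (auto simp: edge_of_def)

lemma card_edge_of:
  assumes x: "x \<in> C"
  shows "card (edge_of x) = 4"
proof -
  have "s x \<noteq> s (t x)" using x by (metis fixpoint_free(2) involution(1))
  then have "distinct [x, s x, t x, s (t x)]"
    using fixpoint_free [OF x] fixpoint_free(1) [OF closed(2) [OF x]] side_ne_seg [OF x] by force
  then show ?thesis using distinct_card [of "[x, s x, t x, s (t x)]"] by (simp add: edge_of_def)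
qed

text \<open>A half-twist at some of the loops changes the sides but not the set of corners of a
  ribbon. The hypothesis covers all partial Petrials.\<close>

lemma orbit_edge_of:
  assumes t': "\<And>y. y \<in> C \<Longrightarrow> t' y = t y \<or> t' y = s (t y)" and x: "x \<in> C"
  shows "(steps C {s, t'})\<^sup>* `` {x} = edge_of x"
proof (rule set_eqI, rule iffI)
  fix y assume "y \<in> (steps C {s, t'})\<^sup>* `` {x}"
  then have "(x, y) \<in> (steps C {s, t'})\<^sup>*" by (simp only: Image_singleton_iff)
  then show "y \<in> edge_of x"
  proof (induction rule: rtrancl_induct)
    case (step y z)
    then have "z = s y \<or> z = t y \<or> z = s (t y)" using t' by (auto elim!: stepsE)
    then show ?case using edge_of_eq [OF step.IH] by (auto simp: edge_of_def)
  qed simp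
next
  fix y assume y: "y \<in> edge_of x"
  let ?r = "(steps C {s, t'})\<^sup>*"
  have "(x, s x) \<in> ?r" using x by (blast intro: stepsI)
  moreover have 1: "(x, t' x) \<in> ?r" using x by (blast intro: stepsI)
  moreover have "t' x \<in> C" using t' [OF x] x by auto
  then have "(t' x, s (t' x)) \<in> ?r" by (blast intro: stepsI)
  ultimately have "(x, s x) \<in> ?r" "(x, t' x) \<in> ?r" "(x, s (t' x)) \<in> ?r"
    by (auto intro: rtrancl_trans)
  then show "y \<in> ?r `` {x}" using y t' [OF x] by (auto simp: edge_of_def)
qed

lemma edges_eq: "edges B = edge_of ` C"
  unfolding edges_def orbits_eq by (intro image_cong refl orbit_edge_of) auto

lemma edgeI [simp]: "x \<in> C \<Longrightarrow> edge_of x \<in> edges B"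
  by (simp add: edges_eq)

lemma edgeD: "e \<in> edges B \<Longrightarrow> x \<in> e \<Longrightarrow> x \<in> C \<and> edge_of x = e"
  by (auto simp: edges_eq dest: edge_of_eq subsetD [OF edge_of_subset])

lemma in_edge_iff: "e \<in> edges B \<Longrightarrow> x \<in> C \<Longrightarrow> x \<in> e \<longleftrightarrow> edge_of x = e"
  using edgeD by auto

lemma finite_edges: "finite (edges B)"
  by (simp add: edges_eq finite_corners)

lemma edge_nonempty: "e \<in> edges B \<Longrightarrow> \<exists>x. x \<in> C \<and> edge_of x = e"
  by (auto simp: edges_eq)

lemma card_corners: "card C = 4 * card (edges B)"
proof -
  have U: "\<Union>(edges B) = C" using edge_of_subset by (force simp: edges_eq)
  have "4 * card (edges B) = card (\<Union>(edges B))"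
  proof (rule card_partition [OF finite_edges])
    show "card e = 4" if "e \<in> edges B" for e using that card_edge_of by (auto simp: edges_eq)
    show "e \<inter> f = {}" if "e \<in> edges B" "f \<in> edges B" "e \<noteq> f" for e f
      using that edgeD by blast
  qed (simp add: U finite_corners)
  then show ?thesis by (simp add: U)
qed

lemma one_vertex: "card (orbits C {s, a}) = 1" "bare B = 0"
proof -
  have "card (orbits C {s, a}) > 0"
    using nonempty finite_corners by (simp add: card_gt_0_iff orbits_eq)
  then show "card (orbits C {s, a}) = 1" "bare B = 0"
    using bouquet by (auto simp: bouquet_def num_vertices_def)
qed

lemma vertex_reach:
  assumes "x \<in> C" "y \<in> C"
  shows "(x, y) \<in> (steps C {s, a})\<^sup>*"
proof -
  obtain q where "orbits C {s, a} = {q}" using one_vertex(1) by (rule card_1_singletonE)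
  then have "(steps C {s, a})\<^sup>* `` {z} = q" if "z \<in> C" for z
    using that unfolding orbits_eq by (metis imageI singletonD)
  from this [OF assms(1)] this [OF assms(2)] show ?thesis by (metis Image_singleton_iff rtrancl.rtrancl_refl)
qed

lemma vertex_induct [consumes 2, case_names base seg arc]:
  assumes "x \<in> C" "y \<in> C" "P x"
    and "\<And>z. z \<in> C \<Longrightarrow> P z \<Longrightarrow> P (s z)" "\<And>z. z \<in> C \<Longrightarrow> P z \<Longrightarrow> P (a z)"
  shows "P y"
  using vertex_reach [OF assms(1,2)] by (induction rule: rtrancl_induct) (use assms(3-) in \<open>auto elim!: stepsE\<close>)

lemma walk_in [simp]: "x \<in> C \<Longrightarrow> (walk ^^ i) x \<in> C"
  by (induction i) (auto simp: walk_apply)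

lemma inj_walk_pow: "inj (walk ^^ i)"
proof -
  have "inj walk" by (rule inj_on_inverseI [where g = "s \<circ> a"]) (simp add: walk_apply)
  then show ?thesis by (induction i) (auto intro: inj_compose simp: inj_on_id)
qed

text \<open>Crossing an end reverses the direction of the walk.\<close>

lemma walk_seg_walk: "(walk ^^ i) (s ((walk ^^ i) x)) = s x"
proof (induction i arbitrary: x)
  case (Suc i)
  have "(walk ^^ Suc i) (s ((walk ^^ Suc i) x)) = walk ((walk ^^ i) (s ((walk ^^ i) (walk x))))"
    by (simp add: funpow_swap1)
  also have "\<dots> = s x" by (simp only: Suc.IH walk_apply involution)
  finally show ?case .
qed simp

text \<open>The boundary circle of a disc is orientable: the walk never arrives at the opposite
  corner of an end. Otherwise, by symmetry, half-way along it would have to meet a fixed point of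
  \<open>s\<close> or of \<open>a\<close>, according to the parity of the number of steps.\<close>

lemma walk_ne_seg:
  assumes x: "x \<in> C"
  shows "(walk ^^ i) x \<noteq> s x"
proof
  assume eq: "(walk ^^ i) x = s x"
  define j where "j = i div 2"
  let ?z = "(walk ^^ j) x"
  have z: "?z \<in> C" using x by simp
  have ret: "(walk ^^ j) (s ?z) = s x" by (rule walk_seg_walk)
  show False
  proof (cases "even i")
    case True
    then have "(walk ^^ j) ?z = (walk ^^ j) (s ?z)"
      using eq ret by (metis comp_apply dvd_mult_div_cancel funpow_add j_def mult_2)
    then have "?z = s ?z" using inj_walk_pow injD by metis
    then show False using z by (metis fixpoint_free(1))
  next
    case False
    then have "i = j + Suc j" unfolding j_def by presburger
    then have "(walk ^^ i) x = (walk ^^ j) ((walk ^^ Suc j) x)" by (simp only: funpow_add comp_apply)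
    then have "(walk ^^ j) (walk ?z) = (walk ^^ j) (s ?z)"
      using eq ret by simp
    then have "walk ?z = s ?z" using inj_walk_pow injD by metis
    then have "a (s ?z) = s ?z" by (simp only: walk_apply)
    then show False using z by (metis closed(1) fixpoint_free(3))
  qed
qed

lemma walk_ne_seg_walk:
  assumes x: "x \<in> C"
  shows "(walk ^^ i) x \<noteq> s ((walk ^^ j) x)"
proof (cases "j \<le> i")
  case True
  then have "(walk ^^ i) x = (walk ^^ (i - j)) ((walk ^^ j) x)"
    by (metis comp_apply funpow_add le_add_diff_inverse2)
  then show ?thesis using walk_ne_seg x by auto
next
  case False
  then have "(walk ^^ j) x = (walk ^^ (j - i)) ((walk ^^ i) x)"
    by (metis comp_apply funpow_add le_add_diff_inverse2 nat_le_linear)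
  then show ?thesis using walk_ne_seg [of "(walk ^^ i) x" "j - i"] x by (metis involution(1) walk_in)
qed

text \<open>The corners visited by the walk and their opposite corners are disjoint and exhaust
  all corners, four for each loop. Hence the period of the walk is twice the number of
  loops.\<close>

lemma walk_structure:
  assumes x: "x \<in> C"
  shows "(walk ^^ (2 * card (edges B))) x = x"
    and "inj_on (\<lambda>i. (walk ^^ i) x) {..<2 * card (edges B)}"
    and "\<And>y. y \<in> C \<Longrightarrow> \<exists>i<2 * card (edges B). y = (walk ^^ i) x \<or> y = s ((walk ^^ i) x)"
proof -
  let ?n = "2 * card (edges B)" and ?w = "\<lambda>i. (walk ^^ i) x"
  have "inj walk" using inj_walk_pow [of 1] by simp
  moreover have "finite {y. \<exists>n. y = ?w n}"
    by (rule finite_subset [OF _ finite_corners]) (use x in auto)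
  ultimately obtain m where "m > 0" "?w m = x" by (rule funpow_inj_finite)
  define L where "L = (LEAST m. m > 0 \<and> ?w m = x)"
  have L: "L > 0" "?w L = x"
    using LeastI [of "\<lambda>m. m > 0 \<and> ?w m = x" m] \<open>m > 0\<close> \<open>?w m = x\<close> by (simp_all add: L_def)
  have less: "?w m \<noteq> x" if "0 < m" "m < L" for m
    using that not_less_Least [of m "\<lambda>m. m > 0 \<and> ?w m = x"] by (auto simp: L_def)
  have inj: "inj_on ?w {..<L}"
  proof (rule linorder_inj_onI)
    fix i j assume "i < j" "i \<in> {..<L}" "j \<in> {..<L}"
    have "?w j = (walk ^^ i) (?w (j - i))"
      using \<open>i < j\<close> by (metis comp_apply funpow_add le_add_diff_inverse less_imp_le)
    then have "?w i = ?w j \<Longrightarrow> x = ?w (j - i)" using injD [OF inj_walk_pow] by metis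
    moreover have "0 < j - i" "j - i < L" using \<open>i < j\<close> \<open>j \<in> {..<L}\<close> by auto
    ultimately show "?w i \<noteq> ?w j" using less [of "j - i"] by metis
  qed auto
  have reduce: "?w i \<in> ?w ` {..<L}" for i
    using funpow_mod_eq [OF L(2), of i] L(1) by (metis imageI lessThan_iff mod_less_divisor)
  let ?O = "?w ` {..<L}"
  have "y \<in> ?O \<union> s ` ?O" if "y \<in> C" for y
    using x that
  proof (induction rule: vertex_induct)
    case base
    show ?case using reduce [of 0] by simp
  next
    case (seg z)
    then show ?case by auto
  next
    case (arc z)
    then consider i where "z = ?w i" "i < L" | i where "z = s (?w i)" by auto
    then show ?case
    proof cases
      case 1
      have "\<exists>k. z = ?w (Suc k)"
      proof (cases i)
        case 0
        then have "z = ?w (Suc (L - 1))" using 1 L by simp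
        then show ?thesis by blast
      qed (use 1 in blast)
      then obtain k where "z = ?w (Suc k)" by blast
      then have "a z = s (?w k)" by (simp add: walk_apply)
      then show ?thesis using reduce by auto
    next
      case 2
      then have "a z = ?w (Suc i)" by (simp add: walk_apply)
      then show ?thesis using reduce [of "Suc i"] by (simp only: UnI1)
    qed
  qed
  moreover have "?O \<union> s ` ?O \<subseteq> C" using x by auto
  ultimately have C_eq: "C = ?O \<union> s ` ?O" by blast
  have "?O \<inter> s ` ?O = {}" using walk_ne_seg_walk [OF x] by blast
  moreover have "card (s ` ?O) = card ?O"
    by (rule card_image) (metis inj_on_def involution(1))
  ultimately have "card C = 2 * card ?O"
    by (subst C_eq) (simp add: card_Un_disjoint)
  also have "card ?O = L" using card_image [OF inj] by simp
  finally have L_eq: "L = ?n" using card_corners by simp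
  show "?w ?n = x" "inj_on ?w {..<?n}" using L(2) inj by (simp_all add: L_eq)
  show "\<exists>i<?n. y = ?w i \<or> y = s (?w i)" if "y \<in> C" for y
    using that C_eq unfolding L_eq by blast
qed

text \<open>The places at which a loop occurs in the cyclic word of ends read along the walk from
  \<open>x\<close>.\<close>

definition positions :: "'c \<Rightarrow> 'c set \<Rightarrow> nat set" where
  "positions x e = {i. i < 2 * card (edges B) \<and> (walk ^^ i) x \<in> e}"

lemma finite_positions [simp]: "finite (positions x e)"
  by (simp add: positions_def)

lemma card_positions:
  assumes x: "x \<in> C" and e: "e \<in> edges B"
  shows "card (positions x e) = 2"
proof -
  let ?w = "\<lambda>i. (walk ^^ i) x"
  let ?P = "?w ` positions x e"
  have s_e: "y \<in> e \<longleftrightarrow> s y \<in> e" for y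
    using edgeD [OF e] by (metis edge_of_self edge_of_step(1) in_edge_iff [OF e] involution(1))
  have "e = ?P \<union> s ` ?P"
  proof
    show "e \<subseteq> ?P \<union> s ` ?P"
    proof
      fix y assume y: "y \<in> e"
      then have "y \<in> C" using edgeD [OF e] by blast
      then obtain i where "i < 2 * card (edges B)" "y = ?w i \<or> y = s (?w i)"
        using walk_structure(3) [OF x] by blast
      then show "y \<in> ?P \<union> s ` ?P" using y s_e by (auto simp: positions_def)
    qed
    show "?P \<union> s ` ?P \<subseteq> e" using s_e by (auto simp: positions_def)
  qed
  moreover have "?P \<inter> s ` ?P = {}" using walk_ne_seg_walk [OF x] by blast
  moreover have "card (s ` ?P) = card ?P"
    by (rule card_image) (metis inj_on_def involution(1))
  ultimately have "card e = 2 * card ?P"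
    by (metis card_Un_disjoint finite_imageI finite_positions mult_2)
  moreover have "card e = 4" using e card_edge_of by (auto simp: edges_eq)
  moreover have "card ?P = card (positions x e)"
    by (rule card_image, rule inj_on_subset [OF walk_structure(2) [OF x]]) (auto simp: positions_def)
  ultimately show ?thesis by simp
qed

section \<open>Potentials\<close>

text \<open>The condition on a loop says that the jump between the two corners of an end is the
  same at both ends of the loop. Both conditions are independent of twists: exchanging
  \<open>t x\<close> and \<open>s (t x)\<close> does not affect them.\<close>

definition potentials :: "('c \<Rightarrow> bit) set" where
  "potentials = {c \<in> vecs C. (\<forall>x\<in>C. c (a x) = c x) \<and>
     (\<forall>x\<in>C. c x + c (s x) = c (t x) + c (s (t x)))}"

definition rep :: "'c set \<Rightarrow> 'c" where
  "rep e = (SOME x. x \<in> e)"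

definition jump :: "('c \<Rightarrow> bit) \<Rightarrow> 'c set \<Rightarrow> bit" where
  "jump c e = (if e \<in> edges B then c (rep e) + c (s (rep e)) else 0)"

definition twisted_side :: "'c set set \<Rightarrow> 'c \<Rightarrow> 'c" where
  "twisted_side A x = (if x \<in> \<Union>A then s (t x) else t x)"

text \<open>The change of colour along a side of the loop \<open>e\<close> once the loops in
  \<open>A\<close> are twisted. It vanishes for all loops exactly if the colours are constant on
  faces.\<close>

definition crossing :: "'c set set \<Rightarrow> ('c \<Rightarrow> bit) \<Rightarrow> 'c set \<Rightarrow> bit" where
  "crossing A c e = (if e \<in> edges B then c (rep e) + c (twisted_side A (rep e)) else 0)"

lemma rep_in: "e \<in> edges B \<Longrightarrow> rep e \<in> e"
  unfolding rep_def by (rule someI_ex) (use edge_nonempty edge_of_self in metis)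

lemma rep_edge_of: "x \<in> C \<Longrightarrow> rep (edge_of x) \<in> C \<and> rep (edge_of x) \<in> edge_of x"
  using rep_in edgeI edgeD by metis

lemma constant_on_edge:
  assumes "\<And>z. z \<in> C \<Longrightarrow> g (s z) = g z" "\<And>z. z \<in> C \<Longrightarrow> g (t z) = g z"
    and "x \<in> C" "y \<in> edge_of x"
  shows "g y = g x"
  using assms(4) assms(1-3) by (auto simp: edge_of_def)

lemma potentialsD:
  assumes "c \<in> potentials"
  shows "x \<notin> C \<Longrightarrow> c x = 0" "c (a x) = c x" "c x + c (s x) = c (t x) + c (s (t x))"
proof -
  have c: "\<forall>x. x \<notin> C \<longrightarrow> c x = 0" "\<forall>x\<in>C. c (a x) = c x"
    "\<forall>x\<in>C. c x + c (s x) = c (t x) + c (s (t x))"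
    using assms unfolding potentials_def vecs_def by blast+
  show "x \<notin> C \<Longrightarrow> c x = 0" using c(1) by blast
  show "c (a x) = c x" using c(2) by (cases "x \<in> C") simp_all
  show "c x + c (s x) = c (t x) + c (s (t x))" 
    using bspec [OF c(3), of x] by (cases "x \<in> C") (blast, simp)
qed

lemma potentialsI:
  assumes "\<And>x. x \<notin> C \<Longrightarrow> c x = 0" "\<And>x. x \<in> C \<Longrightarrow> c (a x) = c x"
    and "\<And>x. x \<in> C \<Longrightarrow> c x + c (s x) = c (t x) + c (s (t x))"
  shows "c \<in> potentials"
  using assms unfolding potentials_def vecs_def by blast

lemma jump_edge_of:
  assumes c: "c \<in> potentials" and x: "x \<in> C"
  shows "jump c (edge_of x) = c x + c (s x)"
proof -
  have "c (rep (edge_of x)) + c (s (rep (edge_of x))) = c x + c (s x)"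
  proof (rule constant_on_edge [where g = "\<lambda>z. c z + c (s z)"])
    show "c (s z) + c (s (s z)) = c z + c (s z)" for z by (simp add: add.commute)
    show "c (t z) + c (s (t z)) = c z + c (s z)" for z by (rule potentialsD(3) [OF c, symmetric])
  qed (use x rep_edge_of in auto)
  then show ?thesis using x by (simp add: jump_def)
qed

lemma in_Union_iff: "A \<subseteq> edges B \<Longrightarrow> x \<in> C \<Longrightarrow> x \<in> \<Union>A \<longleftrightarrow> edge_of x \<in> A"
  using edgeD edge_of_self by blast

lemma crossing_edge_of:
  assumes A: "A \<subseteq> edges B" and c: "c \<in> potentials" and x: "x \<in> C"
  shows "crossing A c (edge_of x) = c x + c (twisted_side A x)"
proof -
  have "c (rep (edge_of x)) + c (twisted_side A (rep (edge_of x))) = c x + c (twisted_side A x)"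
  proof (rule constant_on_edge [where g = "\<lambda>z. c z + c (twisted_side A z)"])
    fix z assume z: "z \<in> C"
    note r = bit_rearrange [OF potentialsD(3) [OF c], of z]
    have "s z \<in> \<Union>A \<longleftrightarrow> z \<in> \<Union>A" "t z \<in> \<Union>A \<longleftrightarrow> z \<in> \<Union>A"
      using in_Union_iff [OF A] z by (simp_all only: closed edge_of_step)
    then show "c (s z) + c (twisted_side A (s z)) = c z + c (twisted_side A z)"
      and "c (t z) + c (twisted_side A (t z)) = c z + c (twisted_side A z)"
      using r by (auto simp: twisted_side_def side_seg add.commute)
  qed (use x rep_edge_of in auto)
  then show ?thesis using x by (simp add: crossing_def)
qed

lemma potential_walk:
  assumes c: "c \<in> potentials" and x: "x \<in> C"
  shows "c ((walk ^^ k) x) = c x + (\<Sum>i<k. jump c (edge_of ((walk ^^ i) x)))"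
proof (induction k)
  case (Suc k)
  let ?y = "(walk ^^ k) x"
  have "c ((walk ^^ Suc k) x) = c (a (s ?y))" by (simp add: walk_apply)
  also have "\<dots> = c ?y + (c ?y + c (s ?y))"
    using potentialsD(2) [OF c] by (simp add: add.assoc [symmetric])
  also have "c ?y + c (s ?y) = jump c (edge_of ?y)"
    using jump_edge_of [OF c, of ?y] x by simp
  finally show ?case using Suc.IH by (simp add: add.assoc)
qed simp

lemma sum_positions:
  assumes x: "x \<in> C" and k: "k \<le> 2 * card (edges B)"
  shows "(\<Sum>i<k. v (edge_of ((walk ^^ i) x)))
    = (\<Sum>e\<in>edges B. of_nat (card {i \<in> positions x e. i < k}) * (v e :: bit))"
proof -
  let ?g = "\<lambda>i. edge_of ((walk ^^ i) x)"
  have "(\<Sum>i<k. v (?g i)) = (\<Sum>e\<in>edges B. \<Sum>i | i \<in> {..<k} \<and> ?g i = e. v (?g i))"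
    by (rule sum.group [symmetric]) (use x finite_edges in auto)
  also have "\<dots> = (\<Sum>e\<in>edges B. of_nat (card {i \<in> positions x e. i < k}) * v e)"
  proof (rule sum.cong [OF refl])
    fix e assume e: "e \<in> edges B"
    have "{i. i \<in> {..<k} \<and> ?g i = e} = {i \<in> positions x e. i < k}"
      using k x in_edge_iff [OF e] by (auto simp: positions_def)
    moreover have "(\<Sum>i | i \<in> {..<k} \<and> ?g i = e. v (?g i)) = (\<Sum>i | i \<in> {..<k} \<and> ?g i = e. v e)"
      by (rule sum.cong) auto
    ultimately show "(\<Sum>i | i \<in> {..<k} \<and> ?g i = e. v (?g i))
        = of_nat (card {i \<in> positions x e. i < k}) * v e" by simp
  qed
  finally show ?thesis .
qed

lemma additive_potentials: "additive_subset potentials"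
proof -
  have "finite potentials"
    by (rule finite_subset [OF _ finite_vecs [OF finite_corners]]) (auto simp: potentials_def)
  moreover have "c + d \<in> potentials" if "c \<in> potentials" "d \<in> potentials" for c d
  proof -
    have "c x + d x + (c (s x) + d (s x)) = c (t x) + d (t x) + (c (s (t x)) + d (s (t x)))" for x
      using potentialsD(3) [OF that(1), of x] potentialsD(3) [OF that(2), of x]
      by (metis add.assoc add.left_commute)
    then show ?thesis
      by (intro potentialsI) (simp_all add: potentialsD(1,2) [OF that(1)] potentialsD(1,2) [OF that(2)])
  qed
  moreover have "0 \<in> potentials" by (rule potentialsI) simp_all
  ultimately show ?thesis by (simp add: additive_subset_def)
qed

lemma jump_add: "jump (c + d) = jump c + jump d"
  by (auto simp: jump_def fun_eq_iff ac_simps)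

lemma crossing_add: "crossing A (c + d) = crossing A c + crossing A d"
  by (auto simp: crossing_def fun_eq_iff ac_simps)

text \<open>The potential is obtained by summing the prescribed jumps along the walk. The sum over
  a full turn vanishes because every loop is passed twice, so the result is well defined.\<close>

lemma jump_surj:
  assumes v: "v \<in> vecs (edges B)"
  shows "\<exists>c\<in>potentials. jump c = v"
proof -
  let ?n = "2 * card (edges B)"
  obtain y where y: "y \<in> C" using nonempty by blast
  let ?w = "\<lambda>i. (walk ^^ i) y"
  define S where "S = (\<lambda>k. \<Sum>i<k. v (edge_of (?w i)))"
  have S_Suc: "S (Suc i) = S i + v (edge_of (?w i))" for i by (simp add: S_def)
  note walk = walk_structure [OF y]
  have "{i \<in> positions y e. i < ?n} = positions y e" for e by (auto simp: positions_def)
  then have S_n: "S ?n = 0"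
    unfolding S_def sum_positions [OF y order.refl]
    using card_positions [OF y] by (intro sum.neutral) (simp add: of_nat_bit)
  define idx where "idx = the_inv_into {..<?n} ?w"
  have idx: "idx (?w i) = i" if "i < ?n" for i
    unfolding idx_def using the_inv_into_f_f [OF walk(2), of i] that by simp
  \<comment> \<open>The colour at a corner off the walk is that of the opposite corner, changed by
    the jump between them.\<close>
  define c where "c = (\<lambda>z. if z \<in> ?w ` {..<?n} then S (idx z)
    else if z \<in> C then S (Suc (idx (s z))) else 0)"
  have c_seg: "c (s (?w i)) = S (Suc i)" if "i < ?n" for i
  proof -
    have "s (?w i) \<notin> ?w ` {..<?n}" 
    proof
      assume "s (?w i) \<in> ?w ` {..<?n}"
      then obtain j where "s (?w i) = ?w j" by (rule imageE)
      then show False using walk_ne_seg_walk [OF y, of j i] by simp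
    qed
    moreover have "s (?w i) \<in> C" using y by simp
    ultimately show ?thesis unfolding c_def by (simp only: if_False if_True involution idx [OF that])
  qed
  have c_walk': "c (?w i) = S i" if "i < ?n" for i
  proof -
    have "?w i \<in> ?w ` {..<?n}" using that by blast
    then show ?thesis unfolding c_def by (simp only: if_True idx [OF that])
  qed
  have npos: "0 < ?n" using edgeI [OF y] finite_edges by (auto simp: card_gt_0_iff)
  have c_walk: "c (?w i) = S i" if "i \<le> ?n" for i
  proof (cases "i = ?n")
    case True
    then have "c (?w i) = c (?w 0)" using walk(1) by simp
    then show ?thesis using c_walk' [OF npos] S_n True by (simp add: S_def)
  qed (use that c_walk' in simp)
  have arc: "c (a z) = c z" if z: "z \<in> C" for z
  proof -
    obtain i where i: "i < ?n" "z = ?w i \<or> z = s (?w i)" using walk(3) [OF z] by blast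
    then consider "z = ?w i" | "z = s (?w i)" by blast
    then show ?thesis
    proof cases
      case 1
      obtain k where k: "k < ?n" "z = ?w (Suc k)"
      proof (cases i)
        case 0
        then have "z = ?w ?n" using 1 walk(1) by simp
        then have "z = ?w (Suc (?n - 1))" using npos by simp
        then show ?thesis using that [of "?n - 1"] npos by simp
      next
        case (Suc k)
        then show ?thesis using that [of k] 1 i(1) by simp
      qed
      have "a z = s (?w k)" using k(2) by (simp add: walk_apply)
      then show ?thesis using k c_seg c_walk [of "Suc k"] by simp
    next
      case 2
      have "a z = ?w (Suc i)" using 2 by (simp add: walk_apply)
      then show ?thesis using 2 i(1) c_seg c_walk [of "Suc i"] by simp
    qed
  qed
  have jmp: "c z + c (s z) = v (edge_of z)" if z: "z \<in> C" for z
  proof -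
    have *: "S i + S (Suc i) = v (edge_of (?w i))" for i
      by (simp add: S_Suc add.assoc [symmetric])
    obtain i where i: "i < ?n" "z = ?w i \<or> z = s (?w i)" using walk(3) [OF z] by blast
    then consider "z = ?w i" | "z = s (?w i)" by blast
    then show ?thesis
    proof cases
      case 1
      then show ?thesis using i(1) c_seg [of i] c_walk [of i] * [of i] by simp
    next
      case 2
      then show ?thesis using i(1) c_seg [of i] c_walk [of i] * [of i] by (simp add: add.commute)
    qed
  qed
  have "c z = 0" if "z \<notin> C" for z
    using that y by (auto simp: c_def)
  moreover have "c z + c (s z) = c (t z) + c (s (t z))" if "z \<in> C" for z
    using jmp [OF that] jmp [OF closed(2) [OF that]] by (simp only: edge_of_step)
  ultimately have pot: "c \<in> potentials" using arc by (intro potentialsI)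
  have "jump c e = v e" for e
  proof (cases "e \<in> edges B")
    case True
    then obtain x where "x \<in> C" "e = edge_of x" using edge_nonempty by blast
    then show ?thesis using jump_edge_of [OF pot] jmp by simp
  next
    case False
    then show ?thesis using v by (simp add: jump_def vecs_def)
  qed
  then have "jump c = v" by (simp add: fun_eq_iff)
  then show ?thesis using pot by blast
qed

lemma jump_image: "jump ` potentials = vecs (edges B)"
proof
  show "jump ` potentials \<subseteq> vecs (edges B)" by (auto simp: vecs_def jump_def)
  show "vecs (edges B) \<subseteq> jump ` potentials" using jump_surj by blast
qed

text \<open>Without jumps a potential is constant, as all corners lie on the same
  vertex-disc.\<close>

lemma jump_kernel: "{c \<in> potentials. jump c = 0} = {0, \<lambda>x. of_bool (x \<in> C)}"
proof
  show "{0, \<lambda>x. of_bool (x \<in> C)} \<subseteq> {c \<in> potentials. jump c = 0}"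
  proof -
    have "(\<lambda>x. of_bool (x \<in> C)) \<in> potentials" "0 \<in> potentials" by (rule potentialsI; simp)+
    moreover have "jump (\<lambda>x. of_bool (x \<in> C)) = 0" "jump 0 = 0"
      using rep_in edgeD by (auto simp: jump_def fun_eq_iff)
    ultimately show ?thesis by simp
  qed
  show "{c \<in> potentials. jump c = 0} \<subseteq> {0, \<lambda>x. of_bool (x \<in> C)}"
  proof
    fix c assume "c \<in> {c \<in> potentials. jump c = 0}"
    then have c: "c \<in> potentials" "jump c = 0" by auto
    obtain y where y: "y \<in> C" using nonempty by blast
    have seg: "c (s z) = c z" if "z \<in> C" for z
      using jump_edge_of [OF c(1) that] c(2) by (cases "c z"; cases "c (s z)") auto
    have "c z = c y" if "z \<in> C" for z
      using y that by (induction rule: vertex_induct) (simp_all add: seg potentialsD(2) [OF c(1)])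
    then have "c = (\<lambda>x. if x \<in> C then c y else 0)"
      using potentialsD(1) [OF c(1)] by (simp add: fun_eq_iff)
    then show "c \<in> {0, \<lambda>x. of_bool (x \<in> C)}"
      by (cases "c y") (auto simp: fun_eq_iff)
  qed
qed

lemma card_potentials: "card potentials = 2 ^ Suc (card (edges B))"
proof -
  have "card potentials = card (jump ` potentials) * card {c \<in> potentials. jump c = 0}"
    by (rule card_additive_image [OF additive_potentials jump_add])
  moreover obtain y where "y \<in> C" using nonempty by blast
  then have "(0 :: 'c \<Rightarrow> bit) \<noteq> (\<lambda>x. of_bool (x \<in> C))" by (auto simp: fun_eq_iff)
  then have "card {c \<in> potentials. jump c = 0} = 2" unfolding jump_kernel by simp
  ultimately show ?thesis by (simp add: jump_image card_vecs finite_edges)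
qed

section \<open>Faces\<close>

lemma side_petrial: "side (partial_petrial B A) = twisted_side A"
  by (simp add: partial_petrial_def twisted_side_def fun_eq_iff)

lemma petrial_simps [simp]:
  "corners (partial_petrial B A) = C" "seg (partial_petrial B A) = s"
  "arc (partial_petrial B A) = a" "bare (partial_petrial B A) = 0"
  using one_vertex(2) by (simp_all add: partial_petrial_def)

lemma pairing_twisted_side:
  assumes A: "A \<subseteq> edges B"
  shows "pairing C (twisted_side A)"
  unfolding pairing_def
proof (intro conjI ballI allI impI)
  fix x assume x: "x \<in> C"
  show "twisted_side A x \<in> C" "twisted_side A x \<noteq> x" using x by (simp_all add: twisted_side_def)
  have "twisted_side A x \<in> \<Union>A \<longleftrightarrow> x \<in> \<Union>A"
    using in_Union_iff [OF A] x by (simp add: twisted_side_def del: Union_iff)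
  then show "twisted_side A (twisted_side A x) = x"
    by (auto simp: twisted_side_def side_seg)
next
  fix x assume "x \<notin> C"
  then show "twisted_side A x = x" by (simp add: twisted_side_def)
qed

text \<open>A potential that is constant along sides and arcs is a colouring of the faces.
  Conversely such a colouring is a potential, since the two sides of a ribbon join the corners of
  its ends.\<close>

lemma crossing_kernel:
  assumes A: "A \<subseteq> edges B"
  shows "{c \<in> potentials. crossing A c = 0}
    = {c \<in> vecs C. \<forall>f\<in>{twisted_side A, a}. \<forall>x\<in>C. c (f x) = c x}"
proof (intro set_eqI iffI)
  fix c assume "c \<in> {c \<in> potentials. crossing A c = 0}"
  then have c: "c \<in> potentials" "crossing A c = 0" by auto
  have "c (twisted_side A x) = c x" if "x \<in> C" for x
    using crossing_edge_of [OF A c(1) that] c(2) by (cases "c x"; cases "c (twisted_side A x)") auto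
  then show "c \<in> {c \<in> vecs C. \<forall>f\<in>{twisted_side A, a}. \<forall>x\<in>C. c (f x) = c x}"
    using potentialsD(1,2) [OF c(1)] by (simp add: vecs_def)
next
  fix c assume c: "c \<in> {c \<in> vecs C. \<forall>f\<in>{twisted_side A, a}. \<forall>x\<in>C. c (f x) = c x}"
  then have side: "c (twisted_side A x) = c x" if "x \<in> C" for x using that by auto
  have "c x + c (s x) = c (t x) + c (s (t x))" if "x \<in> C" for x
  proof -
    have "s x \<in> \<Union>A \<longleftrightarrow> x \<in> \<Union>A" using in_Union_iff [OF A] that by (simp only: closed edge_of_step)
    then show ?thesis
      using side [OF that] side [of "s x"] that
      by (auto simp: twisted_side_def side_seg add.commute split: if_splits)
  qed
  moreover have "c x = 0" if "x \<notin> C" for x using c that by (simp add: vecs_def)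
  moreover have "c (a x) = c x" if "x \<in> C" for x using c that by simp
  ultimately have pot: "c \<in> potentials" by (intro potentialsI)
  have "crossing A c e = 0" for e
  proof (cases "e \<in> edges B")
    case True
    then have "rep e \<in> C" using rep_in edgeD by blast
    then show ?thesis using side by (simp add: crossing_def)
  qed (simp add: crossing_def)
  then show "c \<in> {c \<in> potentials. crossing A c = 0}" using pot by (simp add: fun_eq_iff)
qed

lemma card_crossing_image:
  assumes A: "A \<subseteq> edges B"
  shows "card (crossing A ` potentials) * 2 ^ num_faces (partial_petrial B A) = 2 ^ Suc (card (edges B))"
proof -
  have "card {c \<in> potentials. crossing A c = 0} = 2 ^ card (orbits C {twisted_side A, a})"
    unfolding crossing_kernel [OF A] using pairing_twisted_side [OF A] pairings finite_corners
    by (intro card_invariant_functions) auto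
  moreover have "card potentials = card (crossing A ` potentials) * card {c \<in> potentials. crossing A c = 0}"
    by (rule card_additive_image [OF additive_potentials crossing_add])
  ultimately show ?thesis
    by (simp add: card_potentials num_faces_def side_petrial)
qed

lemma edges_petrial: "edges (partial_petrial B A) = edges B"
  unfolding edges_def orbits_eq by (intro image_cong refl)
    (simp_all add: orbit_edge_of side_petrial twisted_side_def)

lemma num_vertices_petrial: "num_vertices (partial_petrial B A) = 1"
  by (simp add: num_vertices_def one_vertex)

lemma num_components_petrial:
  assumes A: "A \<subseteq> edges B"
  shows "num_components (partial_petrial B A) = 1"
proof -
  let ?S = "{s, twisted_side A, a}"
  have "(steps C ?S)\<^sup>* `` {x} = C" if x: "x \<in> C" for x
  proof
    show "(steps C ?S)\<^sup>* `` {x} \<subseteq> C"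
      using steps_in [of ?S C x] pairings pairing_twisted_side [OF A] x by auto
    have "steps C {s, a} \<subseteq> steps C ?S" by (auto simp: steps_def)
    then have "(x, y) \<in> (steps C ?S)\<^sup>*" if "y \<in> C" for y
      using vertex_reach [OF x that] rtrancl_mono by blast
    then show "C \<subseteq> (steps C ?S)\<^sup>* `` {x}" by blast
  qed
  then have "orbits C ?S = {C}" unfolding orbits_eq using nonempty by auto
  then show ?thesis by (simp add: num_components_def side_petrial)
qed

text \<open>By rank-nullity the image has \<open>2 ^ (n + 1 - f)\<close> elements for
  \<open>n\<close> loops and \<open>f\<close> faces, and with one vertex and one component
  \<open>n + 1 - f\<close> is the Euler genus. It also follows that the latter is not
  negative.\<close>

theorem crossing_rank:
  assumes A: "A \<subseteq> edges B"
  shows "card (crossing A ` potentials) = 2 ^ nat (euler_genus (partial_petrial B A))"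
proof -
  let ?f = "num_faces (partial_petrial B A)" and ?n = "card (edges B)"
  have eq: "card (crossing A ` potentials) * 2 ^ ?f = 2 ^ Suc ?n" by (rule card_crossing_image [OF A])
  then have "(2 :: nat) ^ ?f dvd 2 ^ Suc ?n" by (metis dvd_triv_right)
  then have le: "?f \<le> Suc ?n" by (rule power_dvd_imp_le) simp
  have "euler_genus (partial_petrial B A) = int (Suc ?n - ?f)"
    using le num_vertices_petrial [of A] num_components_petrial [OF A] edges_petrial [of A]
    by (simp add: euler_genus_def)
  moreover have "card (crossing A ` potentials) = 2 ^ (Suc ?n - ?f)"
  proof -
    have "card (crossing A ` potentials) * 2 ^ ?f = 2 ^ (Suc ?n - ?f) * 2 ^ ?f"
      using eq le by (metis le_add_diff_inverse2 power_add)
    then show ?thesis by simp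
  qed
  ultimately show ?thesis by simp
qed

section \<open>The crossing map is the interlacement matrix\<close>

text \<open>How often the walk from \<open>x\<close> passes the loop \<open>f\<close> before place
  \<open>m\<close>. The place \<open>m\<close> will be that of the other end of the loop at
  \<open>x\<close>.\<close>

definition ends_before :: "'c \<Rightarrow> nat \<Rightarrow> 'c set \<Rightarrow> nat" where
  "ends_before x m f = card {i \<in> positions x f. i < m}"

lemma positions_start:
  assumes e: "e \<in> edges B" and x: "x \<in> e"
    and m: "0 < m" "m < 2 * card (edges B)" "(walk ^^ m) x \<in> e"
  shows "positions x e = {0, m}"
proof -
  have "x \<in> C" using e x edgeD by blast
  then have "card (positions x e) = 2" using card_positions e by blast
  moreover have "{0, m} \<subseteq> positions x e" using x m by (auto simp: positions_def)
  moreover have "card {0, m} = 2" using m(1) by simp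
  ultimately show ?thesis by (metis card_subset_eq finite_positions)
qed

lemma other_end:
  assumes e: "e \<in> edges B" and x: "x \<in> e"
  obtains m where "0 < m" "m < 2 * card (edges B)" "(walk ^^ m) x \<in> e"
proof -
  have "x \<in> C" using e x edgeD by blast
  then have "card (positions x e) = 2" using card_positions e by blast
  then obtain i j where ij: "i \<noteq> j" "positions x e = {i, j}" by (meson card_2_iff)
  then have "max i j \<in> positions x e" "0 < max i j" by (auto simp: max_def)
  then show thesis using that [of "max i j"] unfolding positions_def by blast
qed

text \<open>The side at \<open>x\<close> is compared with the walk from \<open>x\<close> to the
  other end of the same loop. The walk may arrive at the opposite corner of that end, which
  accounts for an additional jump of the loop itself.\<close>

lemma crossing_along_walk:
  assumes c: "c \<in> potentials" and e: "e \<in> edges B" and x: "x \<in> e"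
    and m: "0 < m" "m < 2 * card (edges B)" "(walk ^^ m) x \<in> e"
  shows "c x + c (t x) = (\<Sum>f\<in>edges B. of_nat (ends_before x m f) * jump c f)
    + of_bool (t x \<noteq> (walk ^^ m) x) * jump c e"
proof -
  have xC: "x \<in> C" and ex: "edge_of x = e" using e x edgeD by blast+
  obtain i where i: "i < 2 * card (edges B)" "t x = (walk ^^ i) x \<or> t x = s ((walk ^^ i) x)"
    using walk_structure(3) [OF xC closed(2) [OF xC]] by blast
  have "edge_of (t x) = edge_of ((walk ^^ i) x)" using i(2) by (metis edge_of_step(1))
  then have "(walk ^^ i) x \<in> e" using ex by (metis edge_of_self edge_of_step(2))
  then have "i \<in> positions x e" using i(1) by (simp add: positions_def)
  moreover have "i \<noteq> 0" using i(2) xC by (metis fixpoint_free(2) funpow_0 side_ne_seg(1))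
  ultimately have im: "i = m" using positions_start [OF e x m] by simp
  let ?y = "(walk ^^ m) x"
  have yC: "?y \<in> C" using xC by simp
  have "c (t x) = c ?y + of_bool (t x \<noteq> ?y) * jump c e"
  proof (cases "t x = ?y")
    case False
    then have "t x = s ?y" using i(2) im by simp
    moreover have "jump c e = c ?y + c (s ?y)"
      using jump_edge_of [OF c yC] edgeD [OF e m(3)] by simp
    ultimately show ?thesis using False by (simp add: add.assoc [symmetric])
  qed simp
  moreover have "c ?y = c x + (\<Sum>f\<in>edges B. of_nat (ends_before x m f) * jump c f)"
    using potential_walk [OF c xC, of m] sum_positions [OF xC, of m "jump c"] m(2)
    by (simp add: ends_before_def)
  ultimately show ?thesis by (simp add: add.assoc [symmetric])
qed

lemma ends_before_self:
  assumes "e \<in> edges B" "x \<in> e" "0 < m" "m < 2 * card (edges B)" "(walk ^^ m) x \<in> e"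
  shows "ends_before x m e = 1"
proof -
  have "{i \<in> positions x e. i < m} = {0}" using positions_start [OF assms] assms(3) by auto
  then show ?thesis by (simp add: ends_before_def)
qed

text \<open>Both parities are the crossing value at \<open>e\<close> of a potential with a single
  jump at \<open>f\<close>, and this value does not depend on the corner of \<open>e\<close>. This
  avoids a case distinction on direction and starting end.\<close>

lemma ends_before_parity_indep:
  assumes e: "e \<in> edges B" and f: "f \<in> edges B" "e \<noteq> f"
    and x: "x \<in> e" "0 < m" "m < 2 * card (edges B)" "(walk ^^ m) x \<in> e"
    and y: "y \<in> e" "0 < k" "k < 2 * card (edges B)" "(walk ^^ k) y \<in> e"
  shows "odd (ends_before x m f) \<longleftrightarrow> odd (ends_before y k f)"
proof -
  have "(\<lambda>g. of_bool (g = f)) \<in> vecs (edges B)" using f by (auto simp: vecs_def)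
  then obtain c where c: "c \<in> potentials" "jump c = (\<lambda>g. of_bool (g = f))"
    using jump_surj by blast
  have val: "c z + c (t z) = of_bool (odd (ends_before z l f))"
    if "z \<in> e" "0 < l" "l < 2 * card (edges B)" "(walk ^^ l) z \<in> e" for z l
  proof -
    have "(\<Sum>g\<in>edges B. of_nat (ends_before z l g) * of_bool (g = f)) =
        (\<Sum>g\<in>edges B. if g = f then of_nat (ends_before z l f) else (0 :: bit))"
      by (rule sum.cong) auto
    also have "\<dots> = of_bool (odd (ends_before z l f))"
      using f(1) finite_edges by (simp add: of_nat_bit)
    finally show ?thesis
      using crossing_along_walk [OF c(1) e that] f(2) unfolding c(2) by simp
  qed
  have cr: "crossing {} c e = c z + c (t z)" if "z \<in> e" for z
    using crossing_edge_of [of "{}" c z] c(1) edgeD [OF e that] by (simp add: twisted_side_def)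
  have "(of_bool (odd (ends_before x m f)) :: bit) = of_bool (odd (ends_before y k f))"
    using val [OF x] val [OF y] cr [OF x(1)] cr [OF y(1)] by simp
  then show ?thesis by (simp add: of_bool_eq_iff)
qed

text \<open>Since \<open>f\<close> has two ends, an odd number of them between the ends of
  \<open>e\<close> means exactly one, that is, alternation. Independence of the starting corner
  allows any \<open>x\<close> to be used although the definition of interlacement chooses its
  own.\<close>

lemma interlaced_iff_odd:
  assumes e: "e \<in> edges B" and f: "f \<in> edges B" "e \<noteq> f"
    and x: "x \<in> e" "0 < m" "m < 2 * card (edges B)" "(walk ^^ m) x \<in> e"
  shows "interlaced B e f \<longleftrightarrow> odd (ends_before x m f)"
proof
  assume "interlaced B e f"
  then obtain y i j k where y: "0 < i" "i < j" "j < k" "k < 2 * card (edges B)"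
    "y \<in> e" "(walk ^^ i) y \<in> f" "(walk ^^ j) y \<in> e" "(walk ^^ k) y \<in> f"
    unfolding interlaced_def walk_def by blast
  have "y \<in> C" using edgeD e y(5) by blast
  then have "card (positions y f) = 2" using card_positions f by blast
  moreover have "{i, k} \<subseteq> positions y f" using y by (auto simp: positions_def)
  moreover have "card {i, k} = 2" using y by simp
  ultimately have "positions y f = {i, k}" by (metis card_subset_eq finite_positions)
  then have "{l \<in> positions y f. l < j} = {i}" using y by auto
  then have "odd (ends_before y j f)" by (simp add: ends_before_def)
  moreover have "0 < j" "j < 2 * card (edges B)" using y by auto
  ultimately show "odd (ends_before x m f)"
    using ends_before_parity_indep [OF e f x y(5) _ _ y(7)] by blast
next
  assume odd: "odd (ends_before x m f)"
  have xC: "x \<in> C" using edgeD e x(1) by blast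
  let ?L = "{l \<in> positions x f. l < m}"
  have "odd (card ?L)" using odd by (simp add: ends_before_def)
  moreover have "card (positions x f) = 2" using card_positions xC f by blast
  moreover have "card ?L \<le> card (positions x f)" by (intro card_mono) auto
  ultimately have L1: "card ?L = 1"
    by (metis One_nat_def Suc_1 even_numeral le_Suc_eq le_zero_eq odd_one dvd_0_right)
  from L1 obtain i where "?L = {i}" by (rule card_1_singletonE)
  then have i: "i \<in> ?L" by blast
  have "\<not> positions x f \<subseteq> ?L"
    using card_mono [of ?L "positions x f"] L1 \<open>card (positions x f) = 2\<close> by fastforce
  then obtain k where k: "k \<in> positions x f" "\<not> k < m" by blast
  have f_not_e: "z \<in> f \<Longrightarrow> z \<notin> e" for z using edgeD e f by blast
  have "i \<noteq> 0"
  proof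
    assume "i = 0"
    then have "x \<in> f" using i by (simp add: positions_def)
    then show False using f_not_e x(1) by blast
  qed
  moreover have "k \<noteq> m" using k f_not_e x(4) by (auto simp: positions_def)
  ultimately have "0 < i" "i < m" "m < k" "k < 2 * card (edges B)" "(walk ^^ i) x \<in> f" "(walk ^^ k) x \<in> f"
    using i k by (auto simp: positions_def)
  then show "interlaced B e f"
    using x unfolding interlaced_def walk_def by blast
qed

lemma interlaced_sym:
  assumes "e \<in> edges B" "interlaced B e f"
  shows "interlaced B f e"
proof -
  let ?n = "2 * card (edges B)"
  from assms(2) obtain x i j k where x: "0 < i" "i < j" "j < k" "k < ?n"
    "x \<in> e" "(walk ^^ i) x \<in> f" "(walk ^^ j) x \<in> e" "(walk ^^ k) x \<in> f"
    unfolding interlaced_def walk_def by blast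
  have xC: "x \<in> C" using edgeD assms(1) x(5) by blast
  let ?y = "(walk ^^ i) x"
  have shift: "(walk ^^ (l - i)) ?y = (walk ^^ l) x" if "i \<le> l" for l
    using that by (metis comp_apply funpow_add le_add_diff_inverse2)
  have "(walk ^^ (j - i)) ?y \<in> e" "(walk ^^ (k - i)) ?y \<in> f" "(walk ^^ (?n - i)) ?y \<in> e"
    using x walk_structure(1) [OF xC] by (simp_all add: shift)
  moreover have "0 < j - i" "j - i < k - i" "k - i < ?n - i" "?n - i < ?n" using x by auto
  ultimately show ?thesis
    using x(6) unfolding interlaced_def walk_def by blast
qed

lemma fst_intersection_graph [simp]: "fst (intersection_graph B) = edges B"
  by (simp add: intersection_graph_def)

lemma intersection_graph_edge:
  assumes "e \<in> edges B" "f \<in> edges B" "e \<noteq> f"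
  shows "{e, f} \<in> snd (intersection_graph B) \<longleftrightarrow> interlaced B e f"
  using assms interlaced_sym by (auto simp: intersection_graph_def doubleton_eq_iff)

lemma simple_intersection_graph: "simple_graph (intersection_graph B)"
  using finite_edges by (auto simp: simple_graph_def intersection_graph_def)

text \<open>After a half-twist the side ends at the opposite corner of the other end, which adds
  one jump.\<close>

lemma crossing_twist:
  assumes A: "A \<subseteq> edges B" and c: "c \<in> potentials"
  shows "crossing A c e = crossing {} c e + of_bool (e \<in> A) * jump c e"
proof (cases "e \<in> edges B")
  case True
  then obtain x where x: "x \<in> C" "e = edge_of x" using edge_nonempty by blast
  have h: "c (t x) + c (s (t x)) = c x + c (s x)" using potentialsD(3) [OF c] by metis
  have "crossing A c e = c x + c (twisted_side A x)" "crossing {} c e = c x + c (t x)"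
    "jump c e = c x + c (s x)"
    using x crossing_edge_of [OF A c x(1)] crossing_edge_of [of "{}" c x] c jump_edge_of [OF c x(1)]
    by (simp_all add: twisted_side_def)
  moreover have "x \<in> \<Union>A \<longleftrightarrow> e \<in> A" using in_Union_iff [OF A] x by simp
  moreover have "c (s (t x)) = c (t x) + (c x + c (s x))"
    unfolding h [symmetric] by (simp add: add.assoc [symmetric])
  ultimately show ?thesis by (simp add: twisted_side_def add.assoc)
next
  case False
  then show ?thesis using A by (auto simp: crossing_def jump_def)
qed

text \<open>The loops whose ribbon forms a Moebius band with the vertex-disc: a side joins two
  corners at which the walk enters an end. In an annulus each side joins a corner at which the
  walk enters an end to one at which it leaves an end.\<close>

definition moebius_loops :: "'c set set" where
  "moebius_loops = {e \<in> edges B. \<exists>m<2 * card (edges B). t (rep e) = (walk ^^ m) (rep e)}"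

lemma crossing_no_twist:
  assumes c: "c \<in> potentials"
  shows "crossing {} c = mat_vec (edges B) (adj_matrix (intersection_graph B) moebius_loops) (jump c)"
proof
  fix e
  let ?M = "adj_matrix (intersection_graph B) moebius_loops"
  show "crossing {} c e = mat_vec (edges B) ?M (jump c) e"
  proof (cases "e \<in> edges B")
    case e: True
    let ?x = "rep e"
    have x: "?x \<in> e" by (rule rep_in [OF e])
    obtain m where m: "0 < m" "m < 2 * card (edges B)" "(walk ^^ m) ?x \<in> e"
      using other_end [OF e x] by blast
    have xC: "?x \<in> C" "edge_of ?x = e" using edgeD [OF e x] by auto
    have "i = m" if i: "i < 2 * card (edges B)" "t ?x = (walk ^^ i) ?x" for i
    proof -
      have "(walk ^^ i) ?x \<in> e" using i(2) xC by (metis edge_of_self edge_of_step(2))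
      then have "i \<in> positions ?x e" using i by (simp add: positions_def)
      moreover have "i \<noteq> 0" using i(2) xC(1) by (metis fixpoint_free(2) funpow_0)
      ultimately show ?thesis using positions_start [OF e x m] by simp
    qed
    then have un: "e \<in> moebius_loops \<longleftrightarrow> t ?x = (walk ^^ m) ?x"
      using m(2) e by (auto simp: moebius_loops_def)
    have entry: "?M e f = of_nat (ends_before ?x m f)" if "f \<in> edges B" "f \<noteq> e" for f
      using interlaced_iff_odd [OF e that(1) _ x m] intersection_graph_edge [OF e that(1)] that
      by (auto simp: adj_matrix_def of_nat_bit)
    have diag: "?M e e = of_nat (ends_before ?x m e) + of_bool (t ?x \<noteq> (walk ^^ m) ?x)"
      using ends_before_self [OF e x m] un by (simp add: adj_matrix_def)
    have "crossing {} c e = c ?x + c (t ?x)"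
      using e by (simp add: crossing_def twisted_side_def)
    also have "\<dots> = (\<Sum>f\<in>edges B. of_nat (ends_before ?x m f) * jump c f)
        + of_bool (t ?x \<noteq> (walk ^^ m) ?x) * jump c e"
      by (rule crossing_along_walk [OF c e x m])
    also have "\<dots> = (\<Sum>f\<in>edges B. ?M e f * jump c f)"
    proof -
      have "(\<Sum>f\<in>edges B - {e}. ?M e f * jump c f)
          = (\<Sum>f\<in>edges B - {e}. of_nat (ends_before ?x m f) * jump c f)"
        by (rule sum.cong) (use entry in auto)
      then show ?thesis
        unfolding sum.remove [OF finite_edges e] diag by (simp only: distrib_left distrib_right ac_simps)
    qed
    also have "\<dots> = mat_vec (edges B) ?M (jump c) e" using e by (simp add: mat_vec_def)
    finally show ?thesis .
  qed (simp add: crossing_def mat_vec_def)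
qed

lemma crossing_matrix:
  assumes A: "A \<subseteq> edges B" and c: "c \<in> potentials"
  shows "crossing A c
    = mat_vec (edges B) (adj_matrix (intersection_graph B) ((moebius_loops - A) \<union> (A - moebius_loops))) (jump c)"
    (is "_ = mat_vec _ ?N _")
proof
  fix e
  let ?M = "adj_matrix (intersection_graph B) moebius_loops"
  show "crossing A c e = mat_vec (edges B) ?N (jump c) e"
  proof (cases "e \<in> edges B")
    case e: True
    have "(\<Sum>f\<in>edges B - {e}. ?N e f * jump c f) = (\<Sum>f\<in>edges B - {e}. ?M e f * jump c f)"
      by (rule sum.cong) (auto simp: adj_matrix_def)
    moreover have "?N e e = ?M e e + of_bool (e \<in> A)" by (auto simp: adj_matrix_def)
    ultimately show ?thesis
      using e unfolding crossing_twist [OF A c] crossing_no_twist [OF c]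
      by (simp add: mat_vec_def sum.remove [OF finite_edges e] distrib_left distrib_right ac_simps)
  qed (simp add: crossing_def mat_vec_def)
qed

text \<open>Jumps are arbitrary vectors, so the values of the crossing map form the column space
  of its matrix. As \<open>A\<close> varies, the diagonal, a symmetric difference with a fixed
  set, takes all values.\<close>

theorem euler_genus_rank:
  assumes A: "A \<subseteq> edges B"
  shows "card (looped_col_space (intersection_graph B) ((moebius_loops - A) \<union> (A - moebius_loops)))
    = 2 ^ nat (euler_genus (partial_petrial B A))"
proof -
  let ?N = "adj_matrix (intersection_graph B) ((moebius_loops - A) \<union> (A - moebius_loops))"
  have "crossing A ` potentials = mat_vec (edges B) ?N ` jump ` potentials"
    unfolding image_image by (rule image_cong [OF refl crossing_matrix [OF A]])
  then have "crossing A ` potentials = col_space (edges B) ?N"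
    by (simp add: jump_image col_space_def)
  then show ?thesis using crossing_rank [OF A] by (simp add: looped_col_space_def)
qed

section \<open>Prime bouquets have connected intersection graphs\<close>

text \<open>A union \<open>D\<close> of ribbons that fills an interval of the vertex boundary:
  only the arcs at its first corner \<open>u\<close> and its last corner \<open>v\<close> leave
  it. Joining \<open>u\<close> to \<open>v\<close>, and likewise their partners outside, splits
  the bouquet into two ribbon graphs of which it is the join.\<close>

lemma cut_not_prime:
  assumes D: "D \<subseteq> C" "\<And>x. x \<in> D \<Longrightarrow> s x \<in> D" "\<And>x. x \<in> D \<Longrightarrow> t x \<in> D"
    and uv: "u \<in> D" "v \<in> D" "u \<noteq> v" "a u \<notin> D" "a v \<notin> D"
    and arc: "\<And>x. x \<in> D \<Longrightarrow> x \<noteq> u \<Longrightarrow> x \<noteq> v \<Longrightarrow> a x \<in> D"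
  shows "\<not> prime_ribbon_graph B"
proof
  assume prime: "prime_ribbon_graph B"
  define G1 :: "'c ribbon" where "G1 = \<lparr>corners = D, seg = (\<lambda>x. if x \<in> D then s x else x),
    side = (\<lambda>x. if x \<in> D then t x else x), arc = (\<lambda>x. if x \<in> D then a x else x)(u := v, v := u),
    bare = 0\<rparr>"
  define G2 :: "'c ribbon" where "G2 = \<lparr>corners = C - D, seg = (\<lambda>x. if x \<in> C - D then s x else x),
    side = (\<lambda>x. if x \<in> C - D then t x else x),
    arc = (\<lambda>x. if x \<in> C - D then a x else x)(a u := a v, a v := a u), bare = 0\<rparr>"
  have uC: "u \<in> C" "v \<in> C" using uv D(1) by auto
  have aC: "a u \<in> C - D" "a v \<in> C - D" using uv uC by auto
  have a_ne: "a u \<noteq> a v" using uv(3) by (metis involution(3))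
  have arc_eq: "a x = a y \<longleftrightarrow> x = y" for x y by (metis involution(3))
  have co_s: "s x \<in> C - D" if "x \<in> C - D" for x using that D(2) [of "s x"] by auto
  have co_t: "t x \<in> C - D" if "x \<in> C - D" for x using that D(3) [of "t x"] by auto
  have co_a: "a x \<in> C - D" if "x \<in> C - D" "x \<noteq> a u" "x \<noteq> a v" for x
  proof -
    have "a x \<noteq> u" "a x \<noteq> v" using that(2,3) by auto
    then show ?thesis using that(1) arc [of "a x"] by auto
  qed
  have finD: "finite D" using D(1) finite_corners finite_subset by blast
  have "ribbon_graph G1"
    unfolding ribbon_graph_def
  proof (intro conjI ballI)
    show "finite (corners G1)" using finD by (simp add: G1_def)
    show "pairing (corners G1) (seg G1)" "pairing (corners G1) (side G1)"
      using D by (auto simp: pairing_def G1_def)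
    show "pairing (corners G1) (arc G1)"
      using D(1) uv arc by (auto simp: pairing_def G1_def)
    show "seg G1 (side G1 x) = side G1 (seg G1 x)" "side G1 x \<noteq> seg G1 x" if "x \<in> corners G1" for x
      using that D by (auto simp: G1_def side_seg)
  qed
  moreover have "ribbon_graph G2"
    unfolding ribbon_graph_def
  proof (intro conjI ballI)
    show "finite (corners G2)" using finite_corners by (simp add: G2_def)
    show "pairing (corners G2) (seg G2)" "pairing (corners G2) (side G2)"
      using co_s co_t by (auto simp: pairing_def G2_def)
    show "pairing (corners G2) (arc G2)"
      using aC a_ne co_a uv(1,2) by (auto simp: pairing_def G2_def arc_eq)
    show "seg G2 (side G2 x) = side G2 (seg G2 x)" "side G2 x \<noteq> seg G2 x" if "x \<in> corners G2" for x
      using that co_s co_t by (auto simp: G2_def side_seg)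
  qed
  moreover have "edges G1 \<noteq> {}" "edges G2 \<noteq> {}"
    using uv(1) aC(1) unfolding edges_def orbits_eq by (auto simp: G1_def G2_def)
  moreover have "corners G1 \<inter> corners G2 = {}" "u \<in> corners G1" "a u \<in> corners G2"
    using uv(1) aC(1) by (auto simp: G1_def G2_def)
  moreover have "B = join G1 u G2 (a u)"
  proof (rule ribbon.equality)
    show "corners B = corners (join G1 u G2 (a u))"
      using D(1) by (auto simp: join_def G1_def G2_def)
    show "s = seg (join G1 u G2 (a u))" "t = side (join G1 u G2 (a u))"
      by (auto simp: join_def G1_def G2_def fun_eq_iff)
    have "arc G1 u = v" "arc G2 (a u) = a v"
      using uv a_ne by (auto simp: G1_def G2_def)
    then show "a = arc (join G1 u G2 (a u))"
      using uv by (auto simp: join_def G1_def G2_def fun_eq_iff)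
    show "bare B = bare (join G1 u G2 (a u))"
      using one_vertex(2) by (simp add: join_def G1_def G2_def)
  qed simp
  ultimately show False
    using prime unfolding prime_ribbon_graph_def by blast
qed

lemma interlaced_between:
  assumes e: "e \<in> edges B" and f: "f \<in> edges B" "e \<noteq> f" and p: "p \<in> C"
    and ij: "i < j" "i \<in> positions p e" "j \<in> positions p e"
  shows "interlaced B e f \<longleftrightarrow> odd (card {l \<in> positions p f. i < l \<and> l < j})"
proof -
  let ?x = "(walk ^^ i) p" and ?n = "2 * card (edges B)"
  have shift: "(walk ^^ l) ?x = (walk ^^ (l + i)) p" for l by (simp add: funpow_add)
  have x: "?x \<in> e" "0 < j - i" "j - i < ?n" "(walk ^^ (j - i)) ?x \<in> e"
    using ij unfolding shift by (auto simp: positions_def)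
  have xf: "?x \<notin> f" using edgeD e f x(1) by blast
  have "{l \<in> positions p f. i < l \<and> l < j} = (\<lambda>l. l + i) ` {l \<in> positions ?x f. l < j - i}"
  proof (intro set_eqI iffI)
    fix l assume l: "l \<in> {l \<in> positions p f. i < l \<and> l < j}"
    then have "l - i \<in> {l \<in> positions ?x f. l < j - i}"
      by (auto simp: positions_def shift)
    moreover have "l = (l - i) + i" using l by simp
    ultimately show "l \<in> (\<lambda>l. l + i) ` {l \<in> positions ?x f. l < j - i}"
      by (rule image_eqI [rotated])
  next
    fix l assume "l \<in> (\<lambda>l. l + i) ` {l \<in> positions ?x f. l < j - i}"
    then obtain k where k: "l = k + i" "k \<in> positions ?x f" "k < j - i" by blast
    have "(walk ^^ k) ?x \<in> f" using k(2) by (simp add: positions_def)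
    then have "k \<noteq> 0" using xf by (metis funpow_0)
    then show "l \<in> {l \<in> positions p f. i < l \<and> l < j}"
      using k ij(3) by (auto simp: positions_def shift)
  qed
  then have "card {l \<in> positions p f. i < l \<and> l < j} = ends_before ?x (j - i) f"
    by (simp add: ends_before_def card_image)
  then show ?thesis using interlaced_iff_odd [OF e f x] by simp
qed

lemma two_ends_order:
  assumes "p \<in> C" "f \<in> edges B"
  obtains k l where "k < l" "positions p f = {k, l}"
proof -
  obtain k l where kl: "k \<noteq> l" "positions p f = {k, l}"
    using card_positions [OF assms] by (meson card_2_iff)
  show thesis
  proof (cases "k < l")
    case True
    then show ?thesis using kl(2) by (rule that)
  next
    case False
    then have "l < k" "positions p f = {l, k}" using kl by auto
    then show ?thesis by (rule that)
  qed
qed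

text \<open>Suppose that there is a set of loops not interlaced with any loop outside it, and take
  a minimal one, \<open>A\<close>, a component. Between two cyclically consecutive but not
  adjacent ends of \<open>A\<close> there is an interval of ends of other loops. If such a loop
  had its other end elsewhere, it would separate the loops of \<open>A\<close> into those on
  either side of it, none of the former interlaced with the latter, against minimality. So the
  interval consists of whole loops, and the bouquet can be cut there.\<close>

theorem prime_connected:
  assumes prime: "prime_ribbon_graph B"
  shows "connected_graph (intersection_graph B)"
proof (rule ccontr)
  let ?n = "2 * card (edges B)"
  define sep where "sep A \<longleftrightarrow> A \<subseteq> edges B \<and> A \<noteq> {} \<and> A \<noteq> edges B \<and>
    (\<forall>e\<in>A. \<forall>f\<in>edges B - A. \<not> interlaced B e f)" for A
  assume "\<not> connected_graph (intersection_graph B)"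
  then obtain A0 where "A0 \<subseteq> edges B" "A0 \<noteq> {}" "A0 \<noteq> edges B"
    "\<And>e f. e \<in> A0 \<Longrightarrow> f \<in> edges B - A0 \<Longrightarrow> {e, f} \<notin> snd (intersection_graph B)"
    unfolding connected_graph_def fst_intersection_graph by blast
  then have "sep A0"
    unfolding sep_def using intersection_graph_edge by blast
  then obtain A where A: "sep A" and min: "\<And>A'. sep A' \<Longrightarrow> card A \<le> card A'"
    using ex_has_least_nat [of sep A0 card] by blast
  have AE: "A \<subseteq> edges B" and finA: "finite A"
    using A finite_edges finite_subset unfolding sep_def by blast+
  have no: "\<not> interlaced B e f" "\<not> interlaced B f e" if "e \<in> A" "f \<in> edges B" "f \<notin> A" for e f
    using A that interlaced_sym [of f e] unfolding sep_def by blast+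
  \<comment> \<open>A corner where the walk leaves the edges of \<open>A\<close>.\<close>
  obtain e0 f0 where ef0: "e0 \<in> A" "f0 \<in> edges B" "f0 \<notin> A" using A unfolding sep_def by blast
  then obtain y where y: "y \<in> C" "edge_of y = e0" using AE edge_nonempty by blast
  have "positions y f0 \<noteq> {}" using card_positions [OF y(1) ef0(2)] by force
  then obtain i0 where "(walk ^^ i0) y \<in> f0" by (auto simp: positions_def)
  then have i0: "edge_of ((walk ^^ i0) y) \<notin> A" using edgeD ef0 by metis
  define i where "i = (LEAST i. edge_of ((walk ^^ i) y) \<notin> A)"
  have i: "edge_of ((walk ^^ i) y) \<notin> A" 
    unfolding i_def using i0 by (rule LeastI [of "\<lambda>i. edge_of ((walk ^^ i) y) \<notin> A"])
  have "i \<noteq> 0"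
  proof
    assume "i = 0"
    then show False using i y(2) ef0(1) by simp
  qed
  define p where "p = (walk ^^ (i - 1)) y"
  have p: "p \<in> C" using y(1) by (simp add: p_def)
  let ?w = "\<lambda>i. (walk ^^ i) p" and ?g = "\<lambda>i. edge_of ((walk ^^ i) p)"
  have g0: "?g 0 \<in> A"
    using not_less_Least [of "i - 1" "\<lambda>i. edge_of ((walk ^^ i) y) \<notin> A"] \<open>i \<noteq> 0\<close>
    by (simp add: p_def i_def)
  have "?w 1 = (walk ^^ Suc (i - 1)) y" by (simp add: p_def)
  then have g1: "?g 1 \<notin> A" using i \<open>i \<noteq> 0\<close> by simp
  have wC: "?w l \<in> C" for l using p by simp
  have pos: "l \<in> positions p (?g l)" if "l < ?n" for l using that by (simp add: positions_def)
  have pos_g: "?g l = f" if "l \<in> positions p f" "f \<in> edges B" for l f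
    using that edgeD by (auto simp: positions_def)
  \<comment> \<open>The next return of the walk to \<open>A\<close>.\<close>
  obtain m where m: "0 < m" "m < ?n" "?w m \<in> edge_of p"
    using other_end [OF edgeI [OF p] edge_of_self] by blast
  then have gm: "0 < m \<and> ?g m \<in> A" using edge_of_eq g0 by simp
  define k where "k = (LEAST k. 0 < k \<and> ?g k \<in> A)"
  have k: "0 < k" "?g k \<in> A" using LeastI [of "\<lambda>k. 0 < k \<and> ?g k \<in> A", OF gm] by (auto simp: k_def)
  have kn: "k < ?n" using Least_le [of "\<lambda>k. 0 < k \<and> ?g k \<in> A", OF gm] m(2) by (simp add: k_def)
  have gap: "?g l \<notin> A" if "0 < l" "l < k" for l
    using not_less_Least [of l "\<lambda>k. 0 < k \<and> ?g k \<in> A"] that by (auto simp: k_def)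
  have k1: "1 < k" using k g1 by (metis Suc_lessI One_nat_def)
  have closed_gap: "0 < j \<and> j < k" if l: "0 < l" "l < k" and j: "j \<in> positions p (?g l)" for l j
  proof (rule ccontr)
    assume out: "\<not> (0 < j \<and> j < k)"
    let ?e = "?g l"
    have eE: "?e \<in> edges B" using wC by simp
    have gj: "?g j = ?e" by (rule pos_g [OF j eE])
    have e_notA: "?e \<notin> A" by (rule gap [OF l])
    have "j \<noteq> 0" "j \<noteq> k" using gj e_notA g0 k(2) by metis+
    then have lj: "k < j" using out by auto
    have jn: "j < ?n" using j by (simp add: positions_def)
    \<comment> \<open>The loops of the component on the far side of the chord at places
      \<open>l\<close> and \<open>j\<close>.\<close>
    define A1 where "A1 = {f \<in> A. \<exists>q\<in>positions p f. l < q \<and> q < j}"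
    have both: "positions p f \<subseteq> {l<..<j}" if f: "f \<in> A1" for f
    proof -
      have fA: "f \<in> A" "f \<in> edges B" using f AE by (auto simp: A1_def)
      have "\<not> interlaced B ?e f" using no(2) [OF fA(1) eE e_notA] .
      moreover have "?e \<noteq> f" using e_notA fA(1) by blast
      ultimately have ev: "even (card {q \<in> positions p f. l < q \<and> q < j})"
        using interlaced_between [OF eE fA(2) _ p _ pos j] l lj kn by simp
      have nat_2: "N = 2" if "even N" "N \<noteq> 0" "N \<le> 2" for N :: nat using that by presburger
      obtain q where "q \<in> {q \<in> positions p f. l < q \<and> q < j}" using f by (auto simp: A1_def)
      then have "card {q \<in> positions p f. l < q \<and> q < j} \<noteq> 0" by auto
      moreover have two: "card (positions p f) = 2" by (rule card_positions [OF p fA(2)])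
      moreover have "card {q \<in> positions p f. l < q \<and> q < j} \<le> card (positions p f)"
        by (intro card_mono) auto
      ultimately have "card {q \<in> positions p f. l < q \<and> q < j} = card (positions p f)"
        using ev nat_2 by metis
      from card_subset_eq [OF finite_positions _ this]
      have "{q \<in> positions p f. l < q \<and> q < j} = positions p f" by blast
      then have "q \<in> positions p f \<Longrightarrow> l < q \<and> q < j" for q by blast
      then show ?thesis by (simp add: subset_iff)
    qed
    have "?g k \<in> A1" using k(2) pos [OF kn] l(2) lj by (auto simp: A1_def)
    moreover have "?g 0 \<notin> A1"
    proof
      assume "?g 0 \<in> A1"
      then show False using both [of "?g 0"] pos [of 0] kn by auto
    qed
    moreover have "A1 \<subseteq> A" by (auto simp: A1_def)
    moreover have "\<not> interlaced B f h" if f: "f \<in> A1" and h: "h \<in> edges B - A1" for f h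
    proof (cases "h \<in> A")
      case True
      have fE: "f \<in> edges B" "f \<noteq> h" using f h AE by (auto simp: A1_def)
      obtain q r where qr: "q < r" "positions p f = {q, r}" using two_ends_order [OF p fE(1)] by blast
      have "positions p h \<inter> {l<..<j} = {}" using True h by (auto simp: A1_def)
      moreover have "l < q" "r < j" using both [OF f] qr by auto
      ultimately have none: "{d \<in> positions p h. q < d \<and> d < r} = {}" by fastforce
      have "interlaced B f h \<longleftrightarrow> odd (card {d \<in> positions p h. q < d \<and> d < r})"
        using h qr by (intro interlaced_between [OF fE(1) _ fE(2) p]) auto
      then show ?thesis using none by simp
    next
      case False
      then show ?thesis using no(1) f h by (auto simp: A1_def)
    qed
    ultimately have "sep A1" "A1 \<subset> A"
      using AE g0 unfolding sep_def by blast+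
    then show False using min psubset_card_mono [OF finA] by (metis not_le)
  qed
  \<comment> \<open>The corners of the gap, strictly between the places 0 and
    \<open>k\<close>.\<close>
  define D where "D = {z. \<exists>l. 0 < l \<and> l < k \<and> (z = ?w l \<or> z = s (?w l))}"
  have D_side: "t (?w l) \<in> D" if l: "0 < l" "l < k" for l
  proof -
    obtain j where j: "j < ?n" "t (?w l) = ?w j \<or> t (?w l) = s (?w j)"
      using walk_structure(3) [OF p closed(2) [OF wC]] by blast
    then have "edge_of (?w j) = ?g l" by (metis edge_of_step(1) edge_of_step(2))
    then have "j \<in> positions p (?g l)" using pos [OF j(1)] by simp
    then have "0 < j" "j < k" using closed_gap [OF l] by blast+
    then show ?thesis using j(2) unfolding D_def by blast
  qed
  have out: "?w q \<notin> D" "s (?w q) \<notin> D" if "q = 0 \<or> q = k" for q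
  proof -
    have ne: "?w q \<noteq> ?w l" if l: "0 < l" "l < k" for l
    proof
      assume "?w q = ?w l"
      moreover have "q \<in> {..<?n}" "l \<in> {..<?n}" using \<open>q = 0 \<or> q = k\<close> l kn by auto
      ultimately have "q = l" by (rule inj_onD [OF walk_structure(2) [OF p]])
      then show False using \<open>q = 0 \<or> q = k\<close> l by auto
    qed
    have ne_seg: "s (?w q) \<noteq> s (?w l)" if l: "0 < l" "l < k" for l
      using ne [OF l] by (metis involution(1))
    have "?w q \<noteq> s (?w l)" "s (?w q) \<noteq> ?w l" for l
      using walk_ne_seg_walk [OF p, of q l] walk_ne_seg_walk [OF p, of l q] by simp_all
    then show "?w q \<notin> D" "s (?w q) \<notin> D"
      using ne ne_seg unfolding D_def by blast+
  qed
  have "\<not> prime_ribbon_graph B"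
  proof (rule cut_not_prime [of D "?w 1" "s (?w (k - 1))"])
    show "D \<subseteq> C" using wC by (auto simp: D_def)
    show "s x \<in> D" if "x \<in> D" for x using that unfolding D_def by (auto simp del: funpow.simps)
    show "t x \<in> D" if x: "x \<in> D" for x
    proof -
      obtain l where l: "0 < l" "l < k" "x = ?w l \<or> x = s (?w l)" using x unfolding D_def by blast
      then show ?thesis
        using D_side [OF l(1,2)] by (auto simp: side_seg D_def)
    qed
    show "?w 1 \<in> D" using k1 unfolding D_def by blast
    show "s (?w (k - 1)) \<in> D" using k1 unfolding D_def by (intro CollectI exI [of _ "k - 1"]) simp
    show "?w 1 \<noteq> s (?w (k - 1))" by (rule walk_ne_seg_walk [OF p])
    have "a (?w 1) = s (?w 0)" by (simp add: walk_apply)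
    then show "a (?w 1) \<notin> D" using out(2) [of 0] by simp
    have "a (s (?w (k - 1))) = ?w (Suc (k - 1))" by (simp add: walk_apply)
    then show "a (s (?w (k - 1))) \<notin> D" using out(1) [of k] k by simp
    show "a x \<in> D" if x: "x \<in> D" "x \<noteq> ?w 1" "x \<noteq> s (?w (k - 1))" for x
    proof -
      obtain l where l: "0 < l" "l < k" and xl: "x = ?w l \<or> x = s (?w l)" using x(1) unfolding D_def by blast
      show ?thesis
      proof (cases "x = ?w l")
        case True
        then have "l \<noteq> 1" using x(2) by blast
        then obtain q where q: "l = Suc q" "0 < q" using l by (metis One_nat_def Suc_pred' neq0_conv)
        then have "a x = s (?w q)" using True by (simp add: walk_apply)
        then show ?thesis using q l unfolding D_def by (intro CollectI exI [of _ q]) simp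
      next
        case False
        then have xs: "x = s (?w l)" using xl by blast
        then have "l \<noteq> k - 1" using x(3) by blast
        moreover have "a x = ?w (Suc l)" using xs by (simp add: walk_apply)
        ultimately show ?thesis using l unfolding D_def by (intro CollectI exI [of _ "Suc l"]) simp
      qed
    qed
  qed
  then show False using prime by blast
qed

end

section \<open>The lowest degree of the partial Petrial polynomial\<close>

text \<open>All coefficients count something, so no terms cancel.\<close>

lemma lowest_degree_sum_monom:
  assumes "finite S" "S \<noteq> {}"
  shows "lowest_degree (\<Sum>A\<in>S. monom (1 :: int) (g A)) = Min (g ` S)"
proof -
  have coeff: "coeff (\<Sum>A\<in>S. monom (1 :: int) (g A)) d = int (card {A \<in> S. g A = d})" for d
  proof -
    have "coeff (\<Sum>A\<in>S. monom (1 :: int) (g A)) d = (\<Sum>A\<in>S. if g A = d then 1 else 0)"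
      by (simp add: coeff_sum)
    also have "\<dots> = int (card {A \<in> S. g A = d})"
      using assms(1) by (simp add: sum.If_cases Int_def)
    finally show ?thesis .
  qed
  have "coeff (\<Sum>A\<in>S. monom (1 :: int) (g A)) d \<noteq> 0 \<longleftrightarrow> d \<in> g ` S" for d
    unfolding coeff using assms(1) by auto
  then have "lowest_degree (\<Sum>A\<in>S. monom (1 :: int) (g A)) = (LEAST d. d \<in> g ` S)"
    by (simp add: lowest_degree_def)
  also have "\<dots> = Min {d. d \<in> g ` S}"
    by (rule Least_Min) (use assms in auto)
  finally show ?thesis by (simp only: Collect_mem_eq)
qed

theorem theorem4p3:
  fixes B :: "'c ribbon" and n :: nat
  assumes "bouquet B" and "prime_ribbon_graph B" and "card (edges B) = n" and "n \<ge> 3"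
  shows "lowest_degree (partial_petrial_poly B) = 2 \<longleftrightarrow>
    (\<exists>i j k. is_K i j k (intersection_graph B) \<and> (k = 0 \<or> (i + j \<ge> 3 \<and> k \<noteq> 0))) \<or>
    (\<exists>i j k. is_F i j k (intersection_graph B) \<and> (j \<noteq> 0 \<or> (j = 0 \<and> k \<ge> 2)))"
    (is "_ \<longleftrightarrow> ?KF")
proof -
  have "corners B \<noteq> {}"
  proof
    assume "corners B = {}"
    then have "card (edges B) = 0" by (simp add: edges_def orbits_def)
    then show False using assms(3,4) by simp
  qed
  with assms(1) interpret looped_bouquet B by unfold_locales
  let ?I = "intersection_graph B" and ?E = "edges B"
  define g where "g A = nat (euler_genus (partial_petrial B A))" for A
  have finE: "finite (Pow ?E)" using finite_edges by simp
  have low: "lowest_degree (partial_petrial_poly B) = Min (g ` Pow ?E)"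
    unfolding partial_petrial_poly_def g_def by (rule lowest_degree_sum_monom [OF finE]) blast
  have rank: "\<exists>D\<subseteq>?E. card (looped_col_space ?I D) = 2 ^ g A" if "A \<subseteq> ?E" for A
    using euler_genus_rank [OF that] that unfolding g_def
    by (intro exI [of _ "(moebius_loops - A) \<union> (A - moebius_loops)"]) (auto simp: moebius_loops_def)
  have rank': "\<exists>A\<subseteq>?E. card (looped_col_space ?I D) = 2 ^ g A" if D: "D \<subseteq> ?E" for D
  proof -
    let ?A = "(moebius_loops - D) \<union> (D - moebius_loops)"
    have A: "?A \<subseteq> ?E" using D by (auto simp: moebius_loops_def)
    have "(moebius_loops - ?A) \<union> (?A - moebius_loops) = D" by blast
    then show ?thesis using euler_genus_rank [OF A] A unfolding g_def by metis
  qed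
  note simple = simple_intersection_graph
  show ?thesis
  proof
    assume "lowest_degree (partial_petrial_poly B) = 2"
    then have Min: "Min (g ` Pow ?E) = 2" by (simp add: low)
    have "2 \<in> g ` Pow ?E" using Min_in [of "g ` Pow ?E"] finE Min by auto
    then obtain A where A: "A \<subseteq> ?E" "g A = 2" by auto
    then obtain D where D: "card (looped_col_space ?I D) = 4" using rank [of A] by auto
    have ge: "g A \<ge> 2" if "A \<subseteq> ?E" for A
      using Min_le [of "g ` Pow ?E" "g A"] finE that Min by auto
    \<comment> \<open>The graph is not complete: otherwise twisting to the full diagonal gives
      genus at most 1.\<close>
    obtain u v where "u \<in> fst ?I" "v \<in> fst ?I" "u \<noteq> v" "{u, v} \<notin> snd ?I"
    proof (rule ccontr)
      assume "\<not> thesis"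
      with that have "{u, v} \<in> snd ?I" if "u \<in> fst ?I" "v \<in> fst ?I" "u \<noteq> v" for u v
        using that by blast
      then have "card (looped_col_space ?I (fst ?I)) \<le> 2" by (rule complete_graph_col_space_le_2 [OF simple])
      moreover obtain A' where A': "A' \<subseteq> ?E" "card (looped_col_space ?I (fst ?I)) = 2 ^ g A'"
        using rank' [of ?E] by auto
      moreover have "(2 :: nat) ^ 2 \<le> 2 ^ g A'" using ge [OF A'(1)] by (intro power_increasing) auto
      ultimately show False by simp
    qed
    then show ?KF
      by (rule rank_2_classification [OF simple prime_connected [OF assms(2)] _ _ _ _ D])
  next
    assume KF: ?KF
    have "3 \<le> card ?E" using assms by simp
    from KF consider i j k where "is_K i j k ?I" "k = 0 \<or> (i + j \<ge> 3 \<and> k \<noteq> 0)"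
      | i j k where "is_F i j k ?I" "j \<noteq> 0 \<or> k \<ge> 2" by blast
    then have "(\<exists>D\<subseteq>fst ?I. card (looped_col_space ?I D) \<le> 4) \<and> (\<forall>D. card (looped_col_space ?I D) > 2)"
    proof cases
      case 1
      have "i + j \<ge> 3"
      proof (cases "k = 0")
        case True
        then show ?thesis using is_K_card [OF 1(1)] \<open>3 \<le> card ?E\<close> by simp
      qed (use 1(2) in blast)
      then obtain u v w where "u \<in> fst ?I" "v \<in> fst ?I" "w \<in> fst ?I" "u \<noteq> v"
        "{u, w} \<in> snd ?I" "{v, w} \<in> snd ?I" "{u, v} \<notin> snd ?I"
        using is_K_induced_path [OF 1(1)] by blast
      then have "card (looped_col_space ?I D) > 2" for D by (rule induced_path_col_space_gt_2 [OF simple])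
      then show ?thesis using is_K_col_space_le_4 [OF simple 1(1)] by blast
    next
      case 2
      then obtain u v w where "u \<in> fst ?I" "v \<in> fst ?I" "w \<in> fst ?I" "u \<noteq> v"
        "{u, w} \<in> snd ?I" "{v, w} \<in> snd ?I" "{u, v} \<notin> snd ?I"
        using is_F_induced_path [OF 2] by blast
      then have "card (looped_col_space ?I D) > 2" for D by (rule induced_path_col_space_gt_2 [OF simple])
      then show ?thesis using is_F_col_space_le_4 [OF simple 2(1)] by blast
    qed
    then obtain D where D: "D \<subseteq> ?E" "card (looped_col_space ?I D) \<le> 4"
      and gt: "\<And>D. card (looped_col_space ?I D) > 2" by auto
    obtain A where A: "A \<subseteq> ?E" "card (looped_col_space ?I D) = 2 ^ g A" using rank' [OF D(1)] by blast
    then have "(2 :: nat) ^ g A \<le> 2 ^ 2" using D(2) by simp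
    then have le: "g A \<le> 2" by (rule power_le_imp_le_exp [rotated]) simp
    have ge: "2 \<le> g A'" if A': "A' \<subseteq> ?E" for A'
    proof -
      have "(2 :: nat) ^ 1 < 2 ^ g A'" using rank [OF A'] gt by (metis power_one_right)
      then have "1 < g A'" by (rule power_less_imp_less_exp [rotated]) simp
      then show ?thesis by simp
    qed
    have "Min (g ` Pow ?E) = 2"
    proof (rule Min_eqI)
      have "g A = 2" using le ge [OF A(1)] by simp
      then show "2 \<in> g ` Pow ?E" using A(1) by (intro image_eqI [of _ _ A]) simp_all
    qed (use finE ge in auto)
    then show "lowest_degree (partial_petrial_poly B) = 2" by (simp only: low)
  qed
qed

end
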